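(* Let $n\ge 1$ be an integer and let $\delta\in(0,\pi)$. If $\delta>2\operatorname{cov}_{S^n}(k+1)$ for some integer $k\ge 1$, then $\operatorname{conn}(\check{C}(S^n;\pi-\delta))\le k-2$.
   Context: $S^n=\{x\in\mathbb{R}^{n+1} : \|x\|=1\}$ is equipped with the geodesic metric $d(x,y)=\arccos(x\cdot y)\in[0,\pi]$, so it has diameter $\pi$. For a metric space $(X,d)$, write $B(x,r)=\{y\in X : d(y,x)<r\}$ and $B[x,r]=\{y\in X : d(y,x)\le r\}$ for the open and closed balls. Čech complex: for $r>0$, $\check{C}(X;r)$ is the (intrinsic) nerve of the family of open balls $\{B(x,r)\}_{x\in X}$, i.e. the (possibly infinite) simplicial complex with vertex set $X$ in which a finite nonempty subset $\sigma\subseteq X$ is a simplex if and only if $\bigcap_{x\in\sigma}B(x,r)\neq\emptyset$. Simplicial complexes are identified with their geometric realizations. Connectivity: for a nonempty topological space $Y$, $\operatorname{conn}(Y)$ is the maximal $k$ such that $\pi_i(Y)$ is trivial for all $i\le k$ (so $\operatorname{conn}(Y)=-1$ if $Y$ is nonempty and not path-connected, and $\operatorname{conn}(Y)=\infty$ if all homotopy groups are trivial). Covering radius: for an integer $m\ge 1$, $\operatorname{cov}_X(m)$ is the infimum of all $r\ge 0$ such that there exist $x_1,\dots,x_m\in X$ with $\bigcup_{i=1}^m B[x_i,r]=X$. *)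

theory Defs
  imports "HOL-Analysis.Analysis"
begin

section \<open>The sphere with its geodesic metric\<close>

text \<open>The carrier is the one of \<^const>\<open>nsphere\<close>, the unit sphere of $R^{n+1}$ with points encoded as
  functions \<open>nat \<Rightarrow> real\<close> vanishing beyond index \<open>n\<close>.  The value 0 off the carrier is there only
  because \<^locale>\<open>Metric_space\<close> demands that the distance be nonnegative on the whole type.\<close>

definition geodesic_dist :: "nat \<Rightarrow> (nat \<Rightarrow> real) \<Rightarrow> (nat \<Rightarrow> real) \<Rightarrow> real" where
  "geodesic_dist n x y =
     (if x \<in> topspace (nsphere n) \<and> y \<in> topspace (nsphere n)
      then arccos (\<Sum>i\<le>n. x i * y i) else 0)"

definition sphere_metric :: "nat \<Rightarrow> (nat \<Rightarrow> real) metric" where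
  "sphere_metric n = metric (topspace (nsphere n), geodesic_dist n)"

lemma topspace_nsphere_iff:
  "x \<in> topspace (nsphere n) \<longleftrightarrow> (\<Sum>i\<le>n. (x i)\<^sup>2) = 1 \<and> (\<forall>i>n. x i = 0)"
  by (simp add: nsphere)

lemma nsphere_inner_abs_le:
  assumes "x \<in> topspace (nsphere n)" "y \<in> topspace (nsphere n)"
  shows "\<bar>\<Sum>i\<le>n. x i * y i\<bar> \<le> 1"
proof -
  have "(\<Sum>i\<le>n. x i * y i)\<^sup>2 \<le> 1"
    using Cauchy_Schwarz_ineq_sum[of x y "{..n}"] assms by (simp add: topspace_nsphere_iff)
  then show ?thesis by (simp add: abs_square_le_1)
qed

lemma geodesic_triangle:
  assumes x: "x \<in> topspace (nsphere n)" and y: "y \<in> topspace (nsphere n)"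
    and z: "z \<in> topspace (nsphere n)"
  shows "arccos (\<Sum>i\<le>n. x i * z i) \<le> arccos (\<Sum>i\<le>n. x i * y i) + arccos (\<Sum>i\<le>n. y i * z i)"
proof -
  define a where "a = (\<Sum>i\<le>n. x i * y i)"
  define b where "b = (\<Sum>i\<le>n. y i * z i)"
  define c where "c = (\<Sum>i\<le>n. x i * z i)"
  have a: "-1 \<le> a" "a \<le> 1" and b: "-1 \<le> b" "b \<le> 1" and c: "-1 \<le> c" "c \<le> 1"
    using nsphere_inner_abs_le[OF x y] nsphere_inner_abs_le[OF y z] nsphere_inner_abs_le[OF x z]
    by (auto simp: a_def b_def c_def)
  have sq: "(\<Sum>i\<le>n. x i * x i) = 1" "(\<Sum>i\<le>n. y i * y i) = 1" "(\<Sum>i\<le>n. z i * z i) = 1"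
    using x y z by (auto simp: topspace_nsphere_iff power2_eq_square)
  define u where "u = (\<lambda>i. x i - a * y i)"
  define v where "v = (\<lambda>i. z i - b * y i)"
  have "(\<Sum>i\<le>n. u i * v i)
      = (\<Sum>i\<le>n. x i * z i - b * (x i * y i) - a * (y i * z i) + a * b * (y i * y i))"
    by (intro sum.cong) (auto simp: u_def v_def algebra_simps)
  also have "\<dots> = c - a * b"
    by (simp add: sum.distrib sum_subtractf sq flip: sum_distrib_left a_def b_def c_def)
  finally have uv: "(\<Sum>i\<le>n. u i * v i) = c - a * b" .
  have "(\<Sum>i\<le>n. (u i)\<^sup>2) = (\<Sum>i\<le>n. x i * x i - 2 * a * (x i * y i) + a\<^sup>2 * (y i * y i))"
    by (intro sum.cong) (auto simp: u_def power2_eq_square algebra_simps)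
  also have "\<dots> = 1 - a\<^sup>2"
    by (simp add: sum.distrib sum_subtractf sq power2_eq_square flip: sum_distrib_left a_def)
  finally have uu: "(\<Sum>i\<le>n. (u i)\<^sup>2) = 1 - a\<^sup>2" .
  have "(\<Sum>i\<le>n. (v i)\<^sup>2) = (\<Sum>i\<le>n. z i * z i - 2 * b * (y i * z i) + b\<^sup>2 * (y i * y i))"
    by (intro sum.cong) (auto simp: v_def power2_eq_square algebra_simps)
  also have "\<dots> = 1 - b\<^sup>2"
    by (simp add: sum.distrib sum_subtractf sq power2_eq_square flip: sum_distrib_left b_def)
  finally have vv: "(\<Sum>i\<le>n. (v i)\<^sup>2) = 1 - b\<^sup>2" .
  have "(c - a * b)\<^sup>2 \<le> (1 - a\<^sup>2) * (1 - b\<^sup>2)"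
    using Cauchy_Schwarz_ineq_sum[of u v "{..n}"] by (simp add: uu vv uv)
  then have "\<bar>c - a * b\<bar> \<le> sqrt (1 - a\<^sup>2) * sqrt (1 - b\<^sup>2)"
    by (metis real_sqrt_abs real_sqrt_le_iff real_sqrt_mult)
  moreover have "cos (arccos a + arccos b) = a * b - sqrt (1 - a\<^sup>2) * sqrt (1 - b\<^sup>2)"
    using a b by (simp add: cos_add sin_arccos)
  ultimately have le: "cos (arccos a + arccos b) \<le> c" by linarith
  have "arccos c \<le> arccos a + arccos b"
  proof (cases "arccos a + arccos b \<le> pi")
    case True
    then have "arccos c \<le> arccos (cos (arccos a + arccos b))"
      using le c by (intro arccos_le_arccos) auto
    also have "\<dots> = arccos a + arccos b"
      using True a b by (intro arccos_cos) (auto intro!: add_nonneg_nonneg arccos_lbound)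
    finally show ?thesis .
  next
    case False
    then show ?thesis using arccos_ubound[OF c] by linarith
  qed
  then show ?thesis by (simp add: a_def b_def c_def)
qed

lemma Metric_space_geodesic: "Metric_space (topspace (nsphere n)) (geodesic_dist n)"
proof
  fix x y
  show "0 \<le> geodesic_dist n x y"
    using nsphere_inner_abs_le[of x n y] by (auto simp: geodesic_dist_def intro!: arccos_lbound)
  show "geodesic_dist n x y = geodesic_dist n y x"
    by (simp add: geodesic_dist_def mult.commute)
next
  fix x y assume xy: "x \<in> topspace (nsphere n)" "y \<in> topspace (nsphere n)"
  show "geodesic_dist n x y = 0 \<longleftrightarrow> x = y"
  proof
    assume "x = y"
    then show "geodesic_dist n x y = 0"
      using xy by (simp add: geodesic_dist_def topspace_nsphere_iff flip: power2_eq_square)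
  next
    assume "geodesic_dist n x y = 0"
    then have "arccos (\<Sum>i\<le>n. x i * y i) = 0"
      using xy by (simp add: geodesic_dist_def)
    then have 1: "(\<Sum>i\<le>n. x i * y i) = 1"
      using cos_arccos_abs[OF nsphere_inner_abs_le[OF xy]] by simp
    have "(\<Sum>i\<le>n. (x i - y i)\<^sup>2) = (\<Sum>i\<le>n. (x i)\<^sup>2 + (y i)\<^sup>2 - 2 * (x i * y i))"
      by (intro sum.cong) (auto simp: power2_eq_square algebra_simps)
    also have "\<dots> = 0"
      using xy 1 by (simp add: sum.distrib sum_subtractf topspace_nsphere_iff flip: sum_distrib_left)
    finally have "\<forall>i\<le>n. x i = y i" by (simp add: sum_nonneg_eq_0_iff)
    then show "x = y"
      using xy by (metis ext not_le topspace_nsphere_iff)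
  qed
next
  fix x y z assume "x \<in> topspace (nsphere n)" "y \<in> topspace (nsphere n)" "z \<in> topspace (nsphere n)"
  then show "geodesic_dist n x z \<le> geodesic_dist n x y + geodesic_dist n y z"
    by (simp add: geodesic_dist_def geodesic_triangle)
qed

lemma mspace_sphere_metric [simp]: "mspace (sphere_metric n) = topspace (nsphere n)"
  unfolding sphere_metric_def by (rule Metric_space.mspace_metric[OF Metric_space_geodesic])

lemma mdist_sphere_metric [simp]: "mdist (sphere_metric n) = geodesic_dist n"
  unfolding sphere_metric_def by (rule Metric_space.mdist_metric[OF Metric_space_geodesic])


section \<open>Covering radius\<close>

definition covering_radius :: "'a metric \<Rightarrow> nat \<Rightarrow> real" where
  "covering_radius X m =
     Inf {r. 0 \<le> r \<and> (\<exists>x::nat \<Rightarrow> 'a. (\<forall>i\<in>{1..m}. x i \<in> mspace X) \<and>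
                                      (\<Union>i\<in>{1..m}. mcball_of X (x i) r) = mspace X)}"


section \<open>Simplicial complexes, geometric realization and the Cech complex\<close>

text \<open>A simplicial complex is given by its set of simplices (finite nonempty vertex sets).\<close>

definition cech_complex :: "'a metric \<Rightarrow> real \<Rightarrow> 'a set set" where
  "cech_complex X r =
     {\<sigma>. finite \<sigma> \<and> \<sigma> \<noteq> {} \<and> \<sigma> \<subseteq> mspace X \<and> (\<Inter>x\<in>\<sigma>. mball_of X x r) \<noteq> {}}"

text \<open>Points are given by barycentric coordinates.\<close>

definition closed_simplex :: "'a set \<Rightarrow> ('a \<Rightarrow> real) set" where
  "closed_simplex \<sigma> = {t. (\<forall>v. 0 \<le> t v) \<and> (\<forall>v. v \<notin> \<sigma> \<longrightarrow> t v = 0) \<and> sum t \<sigma> = 1}"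

text \<open>The weak (coherent) topology: a set is open iff its trace on each closed simplex is.  On a
  simplex with finitely many vertices the product topology induces the Euclidean one.\<close>

definition geometric_realization :: "'a set set \<Rightarrow> ('a \<Rightarrow> real) topology" where
  "geometric_realization K =
     topology (\<lambda>U. U \<subseteq> (\<Union>\<sigma>\<in>K. closed_simplex \<sigma>) \<and>
       (\<forall>\<sigma>\<in>K. openin (subtopology (powertop_real UNIV) (closed_simplex \<sigma>)) (U \<inter> closed_simplex \<sigma>)))"

lemma openin_geometric_realization:
  fixes K :: "'a set set"
  shows
  "openin (geometric_realization K) U \<longleftrightarrow>
     U \<subseteq> (\<Union>\<sigma>\<in>K. closed_simplex \<sigma>) \<and>
     (\<forall>\<sigma>\<in>K. openin (subtopology (powertop_real UNIV) (closed_simplex \<sigma>)) (U \<inter> closed_simplex \<sigma>))"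
proof -
  have "istopology (\<lambda>U. U \<subseteq> (\<Union>\<sigma>\<in>K. closed_simplex \<sigma>) \<and>
     (\<forall>\<sigma>\<in>K. openin (subtopology (powertop_real UNIV) (closed_simplex \<sigma>)) (U \<inter> closed_simplex \<sigma>)))"
    unfolding istopology_def
  proof (intro conjI allI impI ballI)
    fix S T and \<sigma> :: "'a set"
    let ?X = "subtopology (powertop_real UNIV) (closed_simplex \<sigma>)"
    assume "S \<subseteq> (\<Union>\<sigma>\<in>K. closed_simplex \<sigma>) \<and> (\<forall>\<sigma>\<in>K. openin (subtopology (powertop_real UNIV) (closed_simplex \<sigma>)) (S \<inter> closed_simplex \<sigma>))"
      and "T \<subseteq> (\<Union>\<sigma>\<in>K. closed_simplex \<sigma>) \<and> (\<forall>\<sigma>\<in>K. openin (subtopology (powertop_real UNIV) (closed_simplex \<sigma>)) (T \<inter> closed_simplex \<sigma>))"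
      and "\<sigma> \<in> K"
    then have "openin ?X ((S \<inter> closed_simplex \<sigma>) \<inter> (T \<inter> closed_simplex \<sigma>))"
      by (blast intro: openin_Int)
    then show "openin ?X (S \<inter> T \<inter> closed_simplex \<sigma>)"
      by (simp add: Int_ac)
  next
    fix \<U> and \<sigma> :: "'a set"
    let ?X = "subtopology (powertop_real UNIV) (closed_simplex \<sigma>)"
    assume "\<forall>U\<in>\<U>. U \<subseteq> (\<Union>\<sigma>\<in>K. closed_simplex \<sigma>) \<and> (\<forall>\<sigma>\<in>K. openin (subtopology (powertop_real UNIV) (closed_simplex \<sigma>)) (U \<inter> closed_simplex \<sigma>))"
      and "\<sigma> \<in> K"
    then have "openin ?X (\<Union>U\<in>\<U>. U \<inter> closed_simplex \<sigma>)"
      by (intro openin_Union) auto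
    then show "openin ?X (\<Union>\<U> \<inter> closed_simplex \<sigma>)"
      by (simp add: Int_UN_distrib2 Int_commute)
  qed blast+
  then show ?thesis
    by (simp add: geometric_realization_def topology_inverse')
qed

lemma topspace_geometric_realization [simp]:
  "topspace (geometric_realization K) = (\<Union>\<sigma>\<in>K. closed_simplex \<sigma>)"
proof (rule antisym)
  have "openin (geometric_realization K) (\<Union>\<sigma>\<in>K. closed_simplex \<sigma>)"
    unfolding openin_geometric_realization
  proof (intro conjI ballI)
    fix \<sigma> assume "\<sigma> \<in> K"
    then have "(\<Union>\<sigma>\<in>K. closed_simplex \<sigma>) \<inter> closed_simplex \<sigma> = closed_simplex \<sigma>" by blast
    then show "openin (subtopology (powertop_real UNIV) (closed_simplex \<sigma>))
        ((\<Union>\<sigma>\<in>K. closed_simplex \<sigma>) \<inter> closed_simplex \<sigma>)"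
      using openin_topspace[of "subtopology (powertop_real UNIV) (closed_simplex \<sigma>)"] by simp
  qed simp
  then show "(\<Union>\<sigma>\<in>K. closed_simplex \<sigma>) \<subseteq> topspace (geometric_realization K)"
    by (rule openin_subset)
qed (metis openin_geometric_realization openin_topspace)


section \<open>Homotopy groups and connectivity\<close>

definition sphere_basepoint :: "nat \<Rightarrow> real" where
  "sphere_basepoint = (\<lambda>j. if j = 0 then 1 else 0)"

definition based_sphere_maps :: "nat \<Rightarrow> 'a topology \<Rightarrow> 'a \<Rightarrow> ((nat \<Rightarrow> real) \<Rightarrow> 'a) set" where
  "based_sphere_maps i Y y = {f. continuous_map (nsphere i) Y f \<and> f sphere_basepoint = y}"

text \<open>The underlying set of $\pi_i(Y,y)$: maps $(S^i,*) \to (Y,y)$ modulo based homotopy.  The group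
  structure for \<open>i \<ge> 1\<close> is not needed to say that the group is trivial.  Since $S^0$ has
  two points, the case \<open>i = 0\<close> is the set of path components of \<open>Y\<close>.\<close>

definition homotopy_group :: "nat \<Rightarrow> 'a topology \<Rightarrow> 'a \<Rightarrow> ((nat \<Rightarrow> real) \<Rightarrow> 'a) set set" where
  "homotopy_group i Y y =
     based_sphere_maps i Y y //
       {(f, g). homotopic_with (\<lambda>h. h sphere_basepoint = y) (nsphere i) Y f g}"

definition trivial_homotopy_group :: "nat \<Rightarrow> 'a topology \<Rightarrow> bool" where
  "trivial_homotopy_group i Y \<longleftrightarrow> (\<forall>y\<in>topspace Y. is_singleton (homotopy_group i Y y))"

text \<open>The supremum of the set is its maximum, or \<open>\<infinity>\<close> if all homotopy groups are trivial; the
  constraint always holds for \<open>k = -1\<close>.  Only meaningful for nonempty \<open>Y\<close>.\<close>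

definition conn :: "'a topology \<Rightarrow> ereal" where
  "conn Y = Sup {ereal (real_of_int k) |k::int.
                   -1 \<le> k \<and> (\<forall>i::nat. int i \<le> k \<longrightarrow> trivial_homotopy_group i Y)}"

end

theory Submission
  imports Defs "HOL-Homology.Simplices" "HOL-Library.Z2"
begin

text \<open>Call two points of \<open>S\<^sup>n\<close> adjacent if their distance exceeds \<open>\<delta>\<close> (the Borsuk graph). Since
  \<open>d(x, -y) = \<pi> - d(x, y)\<close>, a finite set has a point of \<open>S\<^sup>n\<close> within distance less than \<open>\<pi> - \<delta>\<close>
  of all its members iff its members have a common neighbour in this graph, so the Cech complex
  is the neighbourhood complex of the Borsuk graph. If \<open>k + 1\<close> closed balls of radius less than
  \<open>\<delta>/2\<close> cover the sphere, then colouring each point by a ball that contains it is a proper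
  colouring, because two points of one ball are at distance less than \<open>\<delta>\<close>. What remains is
  Lovasz' bound: the neighbourhood complex of a \<open>(k + 1)\<close>-colourable graph with an edge cannot
  have trivial \<open>\<pi>\<^sub>0, \<dots>, \<pi>\<^sub>k\<^sub>-\<^sub>1\<close>.

  The bound is proved with simplicial chains modulo 2, in two independent halves.

  Combinatorial half (\<open>acyclic_neighbourhood_complex_not_colourable\<close>). A cell is a pair of
  vertex lists that form a complete bipartite subgraph; exchanging the two lists is a free
  involution \<open>\<tau>\<close> on the cells with both lists nonempty. If the neighbourhood complex has no
  homology below dimension \<open>k\<close>, then neither does the complex of these cells
  (\<open>fill_modulo_left_empty\<close>), so starting from a single edge one finds chains \<open>t\<^sub>2, \<dots>, t\<^sub>k\<^sub>+\<^sub>2\<close>,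
  with \<open>t\<^sub>l\<close> made of cells on \<open>l\<close> vertices, such that \<open>\<partial> t\<^sub>l\<^sub>+\<^sub>1 = t\<^sub>l + \<tau> t\<^sub>l\<close> up to cells with
  an empty list: an algebraic stand-in for an equivariant map of spheres. Counting, as in Ky
  Fan's lemma, the cells of \<open>t\<^sub>l + \<tau> t\<^sub>l\<close> whose vertices, sorted by colour, come alternately
  from the two lists, starting with the left one, gives the same parity for all \<open>l\<close>
  (\<open>alternating_cochain_boundary\<close>). The parity is odd for the edge, and it is even for \<open>l = k +
  2\<close>, because the colours of an alternating cell are distinct.

  Topological half (\<open>acyclic_if_trivial_homotopy_groups\<close>). Triviality of \<open>\<pi>\<^sub>p\<close> means that
  compatible singular \<open>p\<close>-simplices are the faces of a singular \<open>(p + 1)\<close>-simplex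
  (\<open>singular_simplex_with_faces\<close>). Hence one can choose for each simplex of dimension less than
  \<open>k\<close> a singular cone over it, compatibly with faces. After enough barycentric subdivisions,
  replacing each point by a vertex where its barycentric coordinate is largest turns the cones
  into simplicial chains, and these contract the simplicial chain complex below dimension \<open>k\<close>.\<close>

section \<open>Chains modulo 2\<close>

class elementary_two_group = ab_group_add +
  assumes add_self [simp]: "x + x = 0"
begin

lemma add_self_left [simp]: "x + (x + y) = y"
  by (simp flip: add.assoc)

lemma eq_iff_add_eq_0: "x = y \<longleftrightarrow> x + y = 0"
  by (metis add_self add_self_left add_0_right)

end

instance bit :: elementary_two_group
  by standard (simp only: add_bit_eq_xor xor_self_eq)

instance poly_mapping :: (type, elementary_two_group) elementary_two_group
  by standard (simp add: poly_mapping_eq_iff plus_poly_mapping.rep_eq fun_eq_iff)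

type_synonym 'a chain2 = "'a \<Rightarrow>\<^sub>0 bit"

abbreviation gen :: "'a \<Rightarrow> 'a chain2" where
  "gen x \<equiv> Poly_Mapping.single x 1"

text \<open>The linear extension of \<open>f\<close> to chains. The codomain is any group of exponent 2, so that it
  covers both chain maps and \<^typ>\<open>bit\<close>-valued cochains.\<close>

definition lin :: "('a \<Rightarrow> 'b::elementary_two_group) \<Rightarrow> 'a chain2 \<Rightarrow> 'b" where
  "lin f c = sum f (Poly_Mapping.keys c)"

lemma lin_0 [simp]: "lin f 0 = 0"
  by (simp add: lin_def)

lemma lin_gen [simp]: "lin f (gen x) = f x"
  by (simp add: lin_def)

lemma keys_add_chain2:
  fixes a b :: "'a chain2"
  shows "Poly_Mapping.keys (a + b) = (Poly_Mapping.keys a - Poly_Mapping.keys b) \<union> (Poly_Mapping.keys b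
      - Poly_Mapping.keys a)"
proof -
  have "(u + v \<noteq> 0) \<longleftrightarrow> (u \<noteq> 0) \<noteq> (v \<noteq> 0)" for u v :: bit
    by (cases u; cases v) auto
  then show ?thesis
    by (auto simp: in_keys_iff lookup_add simp del: add_bit_eq_xor)
qed

lemma lin_add: "lin f (a + b) = lin f a + lin f b"
proof -
  let ?A = "Poly_Mapping.keys a" and ?B = "Poly_Mapping.keys b"
  have "sum f ?A = sum f (?A - ?B) + sum f (?A \<inter> ?B)"
    using sum.Int_Diff[of ?A f ?B] by (simp add: add.commute)
  moreover have "sum f ?B = sum f (?B - ?A) + sum f (?A \<inter> ?B)"
    using sum.Int_Diff[of ?B f ?A] by (simp add: add.commute Int_commute)
  moreover have "lin f (a + b) = sum f (?A - ?B) + sum f (?B - ?A)"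
    unfolding lin_def keys_add_chain2 by (rule sum.union_disjoint) auto
  ultimately show ?thesis
    by (simp add: lin_def ac_simps)
qed

lemma lin_sum: "lin f (sum g I) = (\<Sum>i\<in>I. lin f (g i))"
  by (induction I rule: infinite_finite_induct) (auto simp: lin_add)

lemma lin_lin: "lin g (lin f c) = lin (\<lambda>x. lin g (f x)) c"
  by (simp add: lin_def[of f] lin_sum) (simp add: lin_def)

lemma lin_fun_add: "lin (\<lambda>x. f x + g x) c = lin f c + lin g c"
  by (simp add: lin_def sum.distrib)

lemma lin_fun_0 [simp]: "lin (\<lambda>x. 0) c = 0"
  by (simp add: lin_def)

lemma lin_cong: "(\<And>x. x \<in> Poly_Mapping.keys c \<Longrightarrow> f x = g x) \<Longrightarrow> lin f c = lin g c"
  by (auto simp: lin_def intro: sum.cong)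

lemma lin_eq_0: "(\<And>x. x \<in> Poly_Mapping.keys c \<Longrightarrow> f x = 0) \<Longrightarrow> lin f c = 0"
  by (simp add: lin_def)

lemma keys_lin: "Poly_Mapping.keys (lin f c) \<subseteq> (\<Union>x\<in>Poly_Mapping.keys c. Poly_Mapping.keys (f x))"
  for f :: "'a \<Rightarrow> 'b chain2"
  unfolding lin_def by (rule keys_sum)

lemma chain2_induct [consumes 1, case_names zero add]:
  assumes "Poly_Mapping.keys c \<subseteq> S"
    and "P 0" and "\<And>x c. x \<in> S \<Longrightarrow> P c \<Longrightarrow> P (gen x + c)"
  shows "P (c :: 'a chain2)"
proof -
  have "P c" if "finite A" "Poly_Mapping.keys c = A" "A \<subseteq> S" for A c
    using that
  proof (induction A arbitrary: c rule: finite_induct)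
    case empty
    then show ?case using assms(2) by auto
  next
    case (insert x A)
    have "Poly_Mapping.keys (gen x + c) = A"
      using insert(2,4) by (simp add: keys_add_chain2)
    from insert.IH[OF this] have "P (gen x + c)" using insert(5) by simp
    from assms(3)[OF _ this, of x] insert(5) have "P (gen x + (gen x + c))" by blast
    then show ?case by simp
  qed
  from this[OF finite_keys refl assms(1)] show ?thesis .
qed

lemma lin_gen_eq [simp]: "lin gen c = c"
  by (induction c rule: chain2_induct[OF subset_UNIV]) (auto simp: lin_add)

section \<open>Ordered simplicial chains\<close>

text \<open>The boundary of an ordered simplex, possibly with repeated vertices, as the alternating
  sum of its faces; signs vanish modulo 2. The complex is the augmented one: a vertex has
  boundary \<open>gen []\<close>. In the recursive form prepending a vertex is visibly a cone construction.\<close>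

primrec tuple_boundary :: "'a list \<Rightarrow> 'a list chain2" where
  "tuple_boundary [] = 0"
| "tuple_boundary (x # xs) = gen xs + lin (\<lambda>ys. gen (x # ys)) (tuple_boundary xs)"

lemma tuple_boundary_tuple_boundary: "lin tuple_boundary (tuple_boundary xs) = 0"
proof (induction xs)
  case (Cons x xs)
  have "lin tuple_boundary (lin (\<lambda>ys. gen (x # ys)) c) = c
      + lin (\<lambda>ys. gen (x # ys)) (lin tuple_boundary c)" for c
    by (simp add: lin_lin lin_fun_add)
  then show ?case using Cons by (simp add: lin_add)
qed simp

definition del :: "nat \<Rightarrow> 'a list \<Rightarrow> 'a list" where
  "del j xs = take j xs @ drop (Suc j) xs"

lemma del_simps [simp]: "del 0 (x # xs) = xs" "del (Suc j) (x # xs) = x # del j xs"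
  by (auto simp: del_def)

lemma tuple_boundary_eq_sum: "tuple_boundary xs = (\<Sum>j<length xs. gen (del j xs))"
  by (induction xs) (simp_all add: sum.lessThan_Suc_shift lin_sum del: sum.lessThan_Suc)

lemma length_del [simp]: "j < length xs \<Longrightarrow> length (del j xs) = length xs - 1"
  by (simp add: del_def)

lemma set_del: "set (del j xs) \<subseteq> set xs"
  by (auto simp: del_def dest: in_set_takeD in_set_dropD)

lemma keys_tuple_boundary:
  assumes "ys \<in> Poly_Mapping.keys (tuple_boundary xs)"
  shows "length xs = Suc (length ys) \<and> set ys \<subseteq> set xs"
proof -
  obtain j where "j < length xs" "ys = del j xs"
    using assms keys_sum[of "\<lambda>j. gen (del j xs)" "{..<length xs}"] by (auto simp: tuple_boundary_eq_sum)
  then show ?thesis using set_del[of j xs] by (cases xs) auto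
qed

text \<open>A cochain that ignores the order of the vertices sums, over the boundary, to its sum over
  all ways to remove one element from a multiset.\<close>

lemma lin_tuple_boundary_mset: "lin (\<lambda>ys. g (mset ys)) (tuple_boundary xs)
    = (\<Sum>x\<in>#mset xs. g (mset xs - {#x#}))"
proof (induction xs arbitrary: g)
  case (Cons x xs)
  have "lin (\<lambda>ys. g (mset ys)) (tuple_boundary (x # xs)) = g (mset xs)
      + lin (\<lambda>ys. g (add_mset x (mset ys))) (tuple_boundary xs)"
    by (simp add: lin_add lin_lin)
  also have "\<dots> = g (mset xs) + (\<Sum>y\<in>#mset xs. g (add_mset x (mset xs - {#y#})))"
    using Cons.IH[of "\<lambda>M. g (add_mset x M)"] by simp
  also have "(\<Sum>y\<in>#mset xs. g (add_mset x (mset xs - {#y#}))) = (\<Sum>y\<in>#mset xs. g (mset (x # xs) - {#y#}))"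
  proof -
    have "image_mset (\<lambda>y. g (add_mset x (mset xs - {#y#}))) (mset xs)
        = image_mset (\<lambda>y. g (mset (x # xs) - {#y#})) (mset xs)"
    proof (rule image_mset_cong)
      fix y assume "y \<in># mset xs"
      then have "add_mset x (mset xs - {#y#}) = mset (x # xs) - {#y#}"
        by (metis add_mset_remove_trivial diff_union_swap insert_DiffM mset.simps(2))
      then show "g (add_mset x (mset xs - {#y#})) = g (mset (x # xs) - {#y#})" by simp
    qed
    then show ?thesis by simp
  qed
  finally show ?case by simp
qed simp

section \<open>Complete bipartite cells\<close>

type_synonym 'a cell = "'a list \<times> 'a list"

text \<open>The boundary of a product of two augmented simplices. Either list may become empty.\<close>

definition cell_boundary :: "'a cell \<Rightarrow> 'a cell chain2" where
  "cell_boundary x = lin (\<lambda>ys. gen (ys, snd x)) (tuple_boundary (fst x))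
      + lin (\<lambda>ys. gen (fst x, ys)) (tuple_boundary (snd x))"

lemma cell_boundary_cell_boundary: "lin cell_boundary (cell_boundary x) = 0"
proof -
  obtain as bs where x: "x = (as, bs)" by force
  have A: "lin (\<lambda>xs. lin (\<lambda>ys. gen (ys, zs)) (tuple_boundary xs)) c
      = lin (\<lambda>ys. gen (ys, zs)) (lin tuple_boundary c)" for c zs
    by (simp add: lin_lin)
  have B: "lin (\<lambda>xs. lin (\<lambda>ys. gen (zs, ys)) (tuple_boundary xs)) c
      = lin (\<lambda>ys. gen (zs, ys)) (lin tuple_boundary c)" for c zs
    by (simp add: lin_lin)
  have C: "lin (\<lambda>xs. lin (\<lambda>ys. gen (xs, ys)) d) c = lin (\<lambda>ys. lin (\<lambda>xs. gen (xs, ys)) c) d" 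
    for c d :: "'a list chain2"
    unfolding lin_def by (rule sum.swap)
  show ?thesis
    by (simp add: x cell_boundary_def lin_add lin_lin lin_fun_add A B C tuple_boundary_tuple_boundary)
qed

lemma keys_cell_boundary:
  assumes "y \<in> Poly_Mapping.keys (cell_boundary x)"
  shows "(fst y \<in> Poly_Mapping.keys (tuple_boundary (fst x)) \<and> snd y = snd x)
       \<or> (fst y = fst x \<and> snd y \<in> Poly_Mapping.keys (tuple_boundary (snd x)))"
proof -
  have "y \<in> Poly_Mapping.keys (lin (\<lambda>ys. gen (ys, snd x)) (tuple_boundary (fst x))) \<or>
    y \<in> Poly_Mapping.keys (lin (\<lambda>ys. gen (fst x, ys)) (tuple_boundary (snd x)))"
    using subsetD[OF keys_add assms[unfolded cell_boundary_def]] by (rule UnE) auto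
  then show ?thesis
    using keys_lin[of "\<lambda>ys. gen (ys, snd x)" "tuple_boundary (fst x)"]
      keys_lin[of "\<lambda>ys. gen (fst x, ys)" "tuple_boundary (snd x)"] by auto
qed

definition has_common_neighbour :: "('a \<Rightarrow> 'a \<Rightarrow> bool) \<Rightarrow> 'a list \<Rightarrow> bool" where
  "has_common_neighbour E xs \<longleftrightarrow> (\<exists>w. \<forall>x\<in>set xs. E x w)"

definition bipartite_cells :: "('a \<Rightarrow> 'a \<Rightarrow> bool) \<Rightarrow> nat \<Rightarrow> 'a cell set" where
  "bipartite_cells E l = {(as, bs). length as + length bs = l \<and> has_common_neighbour E as
      \<and> has_common_neighbour E bs \<and>
                          (\<forall>a\<in>set as. \<forall>b\<in>set bs. E a b)}"

text \<open>Cells with an empty list are errors to be ignored: the complex of interest is the quotient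
  by them. Keeping them makes the boundary a single formula, and the cone construction exact.\<close>

definition one_sided :: "'a cell set" where
  "one_sided = {(as, bs). as = [] \<or> bs = []}"

lemma has_common_neighbour_mono: "has_common_neighbour E xs \<Longrightarrow> set ys \<subseteq> set xs \<Longrightarrow> has_common_neighbour E ys"
  unfolding has_common_neighbour_def by blast

lemma keys_cell_boundary_bipartite:
  assumes "y \<in> Poly_Mapping.keys (cell_boundary x)" "x \<in> bipartite_cells E (Suc l)"
  shows "y \<in> bipartite_cells E l"
  using keys_cell_boundary[OF assms(1)]
proof (elim disjE conjE)
  assume "fst y \<in> Poly_Mapping.keys (tuple_boundary (fst x))" "snd y = snd x"
  then show ?thesis
    using assms(2) keys_tuple_boundary[of "fst y" "fst x"] has_common_neighbour_mono[of E "fst x" "fst y"]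
    by (auto simp: bipartite_cells_def split: prod.splits)
next
  assume "snd y \<in> Poly_Mapping.keys (tuple_boundary (snd x))" "fst y = fst x"
  then show ?thesis
    using assms(2) keys_tuple_boundary[of "snd y" "snd x"] has_common_neighbour_mono[of E "snd x" "snd y"]
    by (auto simp: bipartite_cells_def split: prod.splits)
qed

lemma keys_lin_subset:
  fixes f :: "'a \<Rightarrow> 'b chain2"
  assumes "\<And>x. x \<in> Poly_Mapping.keys c \<Longrightarrow> Poly_Mapping.keys (f x) \<subseteq> S"
  shows "Poly_Mapping.keys (lin f c) \<subseteq> S"
  using assms keys_lin by fast

lemma keys_add_subset:
  fixes a b :: "'a chain2"
  shows "Poly_Mapping.keys a \<subseteq> S \<Longrightarrow> Poly_Mapping.keys b \<subseteq> S \<Longrightarrow> Poly_Mapping.keys (a + b) \<subseteq> S"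
  by (auto simp: keys_add_chain2)

text \<open>The cells over a fixed nonempty left list \<open>as\<close> range over the full augmented simplex on
  the common neighbours of \<open>as\<close>, which is contracted by prepending one chosen common neighbour.
  This contraction \<open>h\<close> does not commute with the boundary of the left list, but \<open>\<partial> h + h \<partial> + 1\<close>
  maps each cell with nonempty left list to cells with shorter left lists, so repeating it
  pushes a relative cycle into the cells with empty left list.\<close>

lemma fill_modulo_left_empty:
  assumes sym: "\<And>a b. E a b \<Longrightarrow> E b a"
    and "Poly_Mapping.keys z \<subseteq> bipartite_cells E l" and "\<forall>x\<in>Poly_Mapping.keys z. length (fst x) \<le> P"
    and "\<forall>x\<in>Poly_Mapping.keys (lin cell_boundary z). fst x = []"
  shows "\<exists>w. Poly_Mapping.keys w \<subseteq> bipartite_cells E (Suc l)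
      \<and> (\<forall>x\<in>Poly_Mapping.keys (lin cell_boundary w + z). fst x = [])"
  using assms(2-)
proof (induction P arbitrary: z)
  case 0
  then have "Poly_Mapping.keys (0::'a cell chain2) \<subseteq> bipartite_cells E (Suc l) \<and>
      (\<forall>x\<in>Poly_Mapping.keys (lin cell_boundary 0 + z). fst x = [])"
    by auto
  then show ?case by blast
next
  case (Suc P)
  define \<beta> where "\<beta> = (\<lambda>xs. SOME w. \<forall>x\<in>set xs. E x w)"
  have \<beta>: "\<forall>x\<in>set xs. E x (\<beta> xs)" if "has_common_neighbour E xs" for xs
    using that unfolding \<beta>_def has_common_neighbour_def by (rule someI_ex)
  define h where "h = (\<lambda>x. if fst x = [] then 0 else gen (fst x, \<beta> (fst x) # snd x))"
  have h_cells: "Poly_Mapping.keys (h x) \<subseteq> bipartite_cells E (Suc m)" if "x \<in> bipartite_cells E m" for x m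
  proof -
    have "has_common_neighbour E (\<beta> (fst x) # snd x)" if ne: "fst x \<noteq> []"
    proof -
      have "\<forall>y\<in>set (\<beta> (fst x) # snd x). E y (hd (fst x))"
        using \<open>x \<in> bipartite_cells E m\<close> ne \<beta>[of "fst x"] sym by (auto simp: bipartite_cells_def)
      then show ?thesis by (auto simp: has_common_neighbour_def)
    qed
    then show ?thesis using that \<beta>[of "fst x"] by (auto simp: h_def bipartite_cells_def)
  qed
  \<comment> \<open>\<open>N\<close> is homotopic to the identity through \<open>h\<close> and shortens nonempty left lists.\<close>
  define N where "N = (\<lambda>x. lin cell_boundary (h x) + lin h (cell_boundary x) + gen x)"
  have "lin h (lin cell_boundary z) = 0"
    using Suc.prems by (intro lin_eq_0) (auto simp: h_def)
  then have z2: "lin cell_boundary (lin h z) + z = lin N z"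
    by (simp add: N_def lin_fun_add lin_lin)
  have N_eq: "N x = (if fst x = [] then gen x else
      lin (\<lambda>ys. gen (ys, \<beta> (fst x) # snd x)) (tuple_boundary (fst x))
          + lin (\<lambda>ys. h (ys, snd x)) (tuple_boundary (fst x)))" for x
  proof -
    have "lin (\<lambda>ys. h (fst x, ys)) (tuple_boundary (snd x))
        = lin (\<lambda>ys. gen (fst x, \<beta> (fst x) # ys)) (tuple_boundary (snd x))"
      if "fst x \<noteq> []" using that by (simp add: h_def)
    then show ?thesis
      by (auto simp: N_def cell_boundary_def lin_add lin_lin lin_fun_add h_def ac_simps)
  qed
  have N_keys: "length (fst y) \<le> P" if y: "y \<in> Poly_Mapping.keys (N x)" and x: "length (fst x) \<le> Suc P"
      for x y
  proof (cases "fst x = []")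
    case True
    then show ?thesis using y by (auto simp: N_eq)
  next
    case False
    have 1: "Poly_Mapping.keys (lin (\<lambda>ys. gen (ys, \<beta> (fst x) # snd x)) (tuple_boundary (fst x)))
        \<subseteq> {y. length (fst y) \<le> P}"
      using x by (intro keys_lin_subset) (auto dest: keys_tuple_boundary)
    have 2: "Poly_Mapping.keys (lin (\<lambda>ys. h (ys, snd x)) (tuple_boundary (fst x)))
        \<subseteq> {y. length (fst y) \<le> P}"
      using x by (intro keys_lin_subset) (auto simp: h_def dest: keys_tuple_boundary)
    show ?thesis using keys_add_subset[OF 1 2] y False by (auto simp: N_eq)
  qed
  let ?z = "lin cell_boundary (lin h z) + z"
  have hz: "Poly_Mapping.keys (lin h z) \<subseteq> bipartite_cells E (Suc l)"
    using Suc.prems h_cells by (intro keys_lin_subset) blast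
  have "Poly_Mapping.keys ?z \<subseteq> bipartite_cells E l"
    using Suc.prems hz by (intro keys_add_subset keys_lin_subset) (auto dest: keys_cell_boundary_bipartite)
  moreover have "\<forall>x\<in>Poly_Mapping.keys ?z. length (fst x) \<le> P"
  proof -
    have "Poly_Mapping.keys (lin N z) \<subseteq> {y. length (fst y) \<le> P}"
      using Suc.prems N_keys by (intro keys_lin_subset) auto
    then show ?thesis unfolding z2 by auto
  qed
  moreover have "lin cell_boundary ?z = lin cell_boundary z"
    by (simp add: lin_add lin_lin cell_boundary_cell_boundary)
  ultimately obtain w where w: "Poly_Mapping.keys w \<subseteq> bipartite_cells E (Suc l)"
     "\<forall>x\<in>Poly_Mapping.keys (lin cell_boundary w + ?z). fst x = []"
    using Suc.IH[of ?z] Suc.prems by auto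
  have "lin cell_boundary (w + lin h z) + z = lin cell_boundary w + ?z"
    by (simp add: lin_add ac_simps)
  then show ?case
    using w hz keys_add_subset by metis
qed

section \<open>Counting alternating cells\<close>

text \<open>The entries alternate, and the first one is \<open>s\<close>.\<close>

primrec alternating :: "bool \<Rightarrow> bool list \<Rightarrow> bool" where
  "alternating s [] = True"
| "alternating s (x # u) = (x = s \<and> alternating (\<not> s) u)"

lemma alternating_map_Not: "alternating s (map Not u) = alternating (\<not> s) u"
  by (induction u arbitrary: s) auto

text \<open>The parity count behind Ky Fan's lemma. Deleting the last entry of an alternating word, or
  the first one, leaves an alternating word, with the starting symbol kept or changed; inner
  deletions create a repetition. A word that is not alternating but becomes so after a deletion
  has exactly one repeated neighbour pair, and the two ways to remove the repetition cancel.\<close>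

lemma alternating_del_count:
  "(\<Sum>j<length u. of_bool (alternating s (del j u))) =
     (of_bool (alternating s u) + of_bool (alternating (\<not> s) u) :: bit)"
proof (induction u arbitrary: s)
  case (Cons x u)
  have "(\<Sum>j<length (x # u). of_bool (alternating s (del j (x # u))) :: bit)
    = of_bool (alternating s u) + (if x = s then \<Sum>j<length u. of_bool (alternating (\<not> s) (del j u)) else 0)"
    by (simp add: sum.lessThan_Suc_shift del: sum.lessThan_Suc add_bit_eq_xor)
  also have "\<dots> = of_bool (alternating s (x # u)) + of_bool (alternating (\<not> s) (x # u))"
    by (auto simp: Cons.IH simp del: add_bit_eq_xor)
  finally show ?case .
qed simp

definition alternating_count :: "nat multiset \<Rightarrow> bit" where
  "alternating_count M = of_bool (alternating True (map even (sorted_list_of_multiset M)))"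

lemma map_del: "map f (del j xs) = del j (map f xs)"
  by (simp add: del_def take_map drop_map)

lemma mset_del: "j < length xs \<Longrightarrow> mset (del j xs) = mset xs - {#xs ! j#}"
proof -
  assume j: "j < length xs"
  have "mset xs = mset (take j xs @ xs ! j # drop (Suc j) xs)"
    using j by (simp add: id_take_nth_drop[symmetric])
  then show ?thesis by (simp add: del_def)
qed

lemma sorted_del: "sorted xs \<Longrightarrow> sorted (del j xs)"
proof (induction xs arbitrary: j)
  case (Cons x xs)
  then show ?case using set_del[of "j - 1" xs] by (cases j) auto
qed (simp add: del_def)

lemma sorted_list_of_multiset_eq: "sorted xs \<Longrightarrow> sorted_list_of_multiset (mset xs) = xs"
  by (simp add: sorted_sort_id)

lemma sum_alternating_count_remove:
  "(\<Sum>n\<in>#M. alternating_count (M - {#n#})) =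
     (of_bool (alternating True (map even (sorted_list_of_multiset M)))
    + of_bool (alternating False (map even (sorted_list_of_multiset M))))"
proof -
  define L where "L = sorted_list_of_multiset M"
  have L: "mset L = M" "sorted L" by (auto simp: L_def)
  have "(\<Sum>n\<in>#M. alternating_count (M - {#n#})) = (\<Sum>n\<leftarrow>L. alternating_count (mset L - {#n#}))"
    unfolding L(1)[symmetric] by (simp add: sum_mset_sum_list flip: mset_map)
  also have "\<dots> = (\<Sum>j<length L. alternating_count (mset L - {#L ! j#}))"
    by (simp add: sum_list_sum_nth atLeast0LessThan)
  also have "\<dots> = (\<Sum>j<length (map even L). of_bool (alternating True (del j (map even L))))"
    using L(2) by (auto simp: alternating_count_def mset_del[symmetric] sorted_list_of_multiset_eq
        sorted_del map_del
        simp del: sorted_list_of_multiset_mset intro!: sum.cong)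
  finally show ?thesis by (simp only: alternating_del_count L_def simp_thms)
qed

text \<open>The vertices of a cell as a single multiset of numbers: the colour is doubled, and the
  parity records the list that the vertex comes from. Sorting these numbers sorts by colour;
  ties between the two lists do not occur in a properly coloured cell.\<close>

definition signed_colours :: "('a \<Rightarrow> nat) \<Rightarrow> 'a cell \<Rightarrow> nat multiset" where
  "signed_colours c x = image_mset (\<lambda>a. 2 * c a) (mset (fst x)) + image_mset (\<lambda>b. 2 * c b
      + 1) (mset (snd x))"

definition signs :: "('a \<Rightarrow> nat) \<Rightarrow> 'a cell \<Rightarrow> bool list" where
  "signs c x = map even (sorted_list_of_multiset (signed_colours c x))"

definition alternating_cochain :: "('a \<Rightarrow> nat) \<Rightarrow> 'a cell \<Rightarrow> bit" where
  "alternating_cochain c x = of_bool (alternating True (signs c x))"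

text \<open>Modulo 2, the cochain \<open>a\<close> that detects alternating cells starting on the left satisfies \<open>a
  \<circ> \<partial> = a + a \<circ> \<tau>\<close> on properly coloured cells, as the second summand is then the value on the
  swapped cell.\<close>

lemma alternating_cochain_boundary: "lin (alternating_cochain c) (cell_boundary x)
    = of_bool (alternating True (signs c x)) + of_bool (alternating False (signs c x))"
proof -
  obtain as bs where x: "x = (as, bs)" by force
  define M where "M = signed_colours c x"
  define A B where "A = image_mset (\<lambda>a. 2 * c a) (mset as)" and "B = image_mset (\<lambda>b. 2 * c b + 1) (mset bs)"
  have alpha_eq: "alternating_cochain c (as', bs')
      = alternating_count (image_mset (\<lambda>a. 2 * c a) (mset as') + image_mset (\<lambda>b. 2 * c b
          + 1) (mset bs'))" for as' bs'
    by (simp add: alternating_cochain_def signs_def signed_colours_def alternating_count_def)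
  have AB: "M = A + B" by (simp add: M_def A_def B_def signed_colours_def x)
  have "lin (\<lambda>ys. alternating_cochain c (ys, bs)) (tuple_boundary as)
      = (\<Sum>a\<in>#mset as. alternating_count (image_mset (\<lambda>a. 2 * c a) (mset as - {#a#}) + B))"
    unfolding alpha_eq B_def[symmetric] by (rule lin_tuple_boundary_mset)
  also have "\<dots> = (\<Sum>a\<in>#mset as. alternating_count (M - {#2 * c a#}))"
    by (intro arg_cong[of _ _ sum_mset] image_mset_cong)
      (auto simp: AB A_def image_mset_Diff dest!: multi_member_split)
  also have "\<dots> = (\<Sum>n\<in>#A. alternating_count (M - {#n#}))"
    by (simp add: A_def image_mset.compositionality comp_def)
  finally have 1: "lin (\<lambda>ys. alternating_cochain c (ys, bs)) (tuple_boundary as)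
      = (\<Sum>n\<in>#A. alternating_count (M - {#n#}))" .
  have "lin (\<lambda>ys. alternating_cochain c (as, ys)) (tuple_boundary bs)
      = (\<Sum>a\<in>#mset bs. alternating_count (A + image_mset (\<lambda>b. 2 * c b + 1) (mset bs - {#a#})))"
    unfolding alpha_eq A_def[symmetric] by (rule lin_tuple_boundary_mset)
  also have "\<dots> = (\<Sum>a\<in>#mset bs. alternating_count (M - {#2 * c a + 1#}))"
    by (intro arg_cong[of _ _ sum_mset] image_mset_cong)
      (auto simp: AB B_def image_mset_Diff dest!: multi_member_split)
  also have "\<dots> = (\<Sum>n\<in>#B. alternating_count (M - {#n#}))"
    by (simp add: B_def image_mset.compositionality comp_def)
  finally have 2: "lin (\<lambda>ys. alternating_cochain c (as, ys)) (tuple_boundary bs)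
      = (\<Sum>n\<in>#B. alternating_count (M - {#n#}))" .
  have "lin (alternating_cochain c) (cell_boundary x) = (\<Sum>n\<in>#M. alternating_count (M - {#n#}))"
    using 1 2 by (simp add: x cell_boundary_def lin_add lin_lin AB del: add_bit_eq_xor)
  then show ?thesis
    unfolding sum_alternating_count_remove by (simp only: signs_def M_def)
qed

text \<open>Exchanging the lists changes all parities but not the order, because in a properly
  coloured cell different numbers with equal halves do not occur.\<close>

lemma signs_swap:
  assumes "\<And>a b. a \<in> set (fst x) \<Longrightarrow> b \<in> set (snd x) \<Longrightarrow> c a \<noteq> c b"
  shows "signs c (prod.swap x) = map Not (signs c x)"
proof -
  define flip where "flip n = (if even n then n + 1 else n - 1)" for n :: nat
  define L where "L = sorted_list_of_multiset (signed_colours c x)"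
  have setL: "set L = (\<lambda>a. 2 * c a) ` set (fst x) \<union> (\<lambda>b. 2 * c b + 1) ` set (snd x)"
    by (simp add: L_def signed_colours_def)
  have "mset (map flip L) = image_mset flip (signed_colours c x)"
    by (simp add: L_def)
  also have "\<dots> = signed_colours c (prod.swap x)"
    by (simp add: signed_colours_def flip_def image_mset.compositionality comp_def)
  finally have "mset (map flip L) = signed_colours c (prod.swap x)" .
  moreover have "sorted (map flip L)"
  proof -
    have "flip m \<le> flip n" if "m \<in> set L" "n \<in> set L" "m \<le> n" for m n
    proof (cases "m = n")
      case False
      then have "m div 2 \<noteq> n div 2"
        using that(1,2) by (auto simp: setL dest: assms assms[THEN not_sym])
      with \<open>m \<le> n\<close> have "m div 2 < n div 2"
        using div_le_mono[of m n 2] by linarith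
      then show ?thesis unfolding flip_def by presburger
    qed simp
    moreover have "sorted L" by (simp add: L_def)
    ultimately show ?thesis
      by (auto simp: sorted_map intro: sorted_wrt_mono_rel)
  qed
  ultimately have "sorted_list_of_multiset (signed_colours c (prod.swap x)) = map flip L"
    using sorted_list_of_multiset_eq by metis
  then show ?thesis
    by (auto simp: signs_def L_def flip_def)
qed

lemma alternating_cochain_swap:
  assumes "\<And>a b. a \<in> set (fst x) \<Longrightarrow> b \<in> set (snd x) \<Longrightarrow> c a \<noteq> c b"
  shows "alternating_cochain c (prod.swap x) = of_bool (alternating False (signs c x))"
  using signs_swap[of x c, OF assms] by (simp add: alternating_cochain_def alternating_map_Not)

text \<open>Neighbouring entries of an alternating cell come from different lists, hence have
  different colours; so the sorted colours increase strictly, and there are no more vertices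
  than colours.\<close>

lemma alternating_length_le:
  assumes "alternating s (signs c x)"
    and "\<And>a b. a \<in> set (fst x) \<Longrightarrow> b \<in> set (snd x) \<Longrightarrow> c a \<noteq> c b"
    and "\<And>a. a \<in> set (fst x) \<union> set (snd x) \<Longrightarrow> c a \<le> k"
  shows "length (fst x) + length (snd x) \<le> Suc k"
proof -
  define L where "L = sorted_list_of_multiset (signed_colours c x)"
  have setL: "set L = (\<lambda>a. 2 * c a) ` set (fst x) \<union> (\<lambda>b. 2 * c b + 1) ` set (snd x)"
    by (simp add: L_def signed_colours_def)
  have eq: "m = n" if "m \<in> set L" "n \<in> set L" "m div 2 = n div 2" for m n
    using that by (auto simp: setL dest: assms(2) assms(2)[THEN not_sym])
  have "distinct (map (\<lambda>n. n div 2) xs)" if "sorted xs" "alternating s (map even xs)" "set xs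
      \<subseteq> set L" for xs s
    using that
  proof (induction xs arbitrary: s)
    case (Cons n xs)
    have "n div 2 \<noteq> m div 2" if m: "m \<in> set xs" for m
    proof
      assume "n div 2 = m div 2"
      then have nm: "n = m" using eq m Cons.prems by auto
      obtain y ys where xs: "xs = y # ys" using m by (cases xs) auto
      then have "n \<le> y" "y \<le> m" using Cons.prems m by auto
      then show False using nm Cons.prems xs by auto
    qed
    then show ?case using Cons by auto
  qed simp
  then have "distinct (map (\<lambda>n. n div 2) L)"
    using assms(1) by (auto simp: L_def signs_def)
  moreover have "set (map (\<lambda>n. n div 2) L) \<subseteq> {..k}"
    using assms(3) by (auto simp: setL)
  ultimately have "length L \<le> card {..k}"
    by (metis card_mono distinct_card finite_atMost length_map)
  moreover have "length L = length (fst x) + length (snd x)"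
    by (simp add: L_def signed_colours_def flip: size_mset)
  ultimately show ?thesis by simp
qed

lemma alternating_cochain_one_sided:
  assumes "x \<in> one_sided" "length (fst x) + length (snd x) \<ge> 2"
  shows "alternating_cochain c x = 0"
proof -
  define L where "L = sorted_list_of_multiset (signed_colours c x)"
  have setL: "set L = (\<lambda>a. 2 * c a) ` set (fst x) \<union> (\<lambda>b. 2 * c b + 1) ` set (snd x)"
    by (simp add: L_def signed_colours_def)
  have "length L = length (fst x) + length (snd x)"
    by (simp add: L_def signed_colours_def flip: size_mset)
  then obtain m n l where L: "L = m # n # l"
    using assms(2) by (cases L; cases "tl L") auto
  have "even m = even n"
  proof (cases "fst x = []")
    case True
    then have "\<forall>i\<in>set L. odd i" by (auto simp: setL)
    then show ?thesis by (simp add: L)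
  next
    case False
    then have "\<forall>i\<in>set L. even i" using assms(1) by (auto simp: setL one_sided_def)
    then show ?thesis by (simp add: L)
  qed
  then show ?thesis
    by (simp add: alternating_cochain_def signs_def L flip: L_def)
qed

section \<open>The combinatorial obstruction\<close>

text \<open>Forgets the right list if it is a single vertex, and kills all other cells: the chain map
  from bipartite cells to the neighbourhood complex, modulo one-sided cells.\<close>

definition project_left :: "'a cell \<Rightarrow> 'a list chain2" where
  "project_left x = (if length (snd x) = 1 then gen (fst x) else 0)"

abbreviation swap_chain :: "'a cell chain2 \<Rightarrow> 'a cell chain2" where
  "swap_chain \<equiv> lin (\<lambda>x. gen (prod.swap x))"

lemma right_empty_part_of_boundary:
  assumes "x \<notin> one_sided"
  shows "lin (\<lambda>y. if snd y = [] then gen y else 0) (cell_boundary x)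
      = lin (\<lambda>as. gen (as, [])) (project_left x)"
proof -
  let ?q = "\<lambda>y::'a cell. if snd y = [] then gen y else 0"
  obtain b bs where b: "snd x = b # bs"
    using assms by (cases x; cases "snd x") (auto simp: one_sided_def)
  have "lin ?q (cell_boundary x) = lin (\<lambda>ys. ?q (fst x, ys)) (tuple_boundary (snd x))"
    by (simp add: cell_boundary_def lin_add lin_lin b)
  also have "\<dots> = lin (\<lambda>as. gen (as, [])) (project_left x)"
  proof (cases bs)
    case Nil
    then show ?thesis by (simp add: b project_left_def)
  next
    case (Cons b' bs')
    have "ys \<noteq> []" if "ys \<in> Poly_Mapping.keys (tuple_boundary (snd x))" for ys
      using keys_tuple_boundary[OF that] Cons b by auto
    then have "lin (\<lambda>ys. ?q (fst x, ys)) (tuple_boundary (snd x)) = 0"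
      by (intro lin_eq_0) auto
    then show ?thesis by (simp add: b Cons project_left_def)
  qed
  finally show ?thesis .
qed

text \<open>The terms \<open>(as, [])\<close> in the boundary of a chain arise only from cells \<open>(as, [b])\<close>, so
  adding the projection cancels them.\<close>

lemma left_empty_after_correction:
  assumes z: "Poly_Mapping.keys z \<inter> one_sided = {}"
    and b: "Poly_Mapping.keys (lin cell_boundary z) \<subseteq> one_sided"
  shows "\<forall>x\<in>Poly_Mapping.keys (lin cell_boundary z
      + lin (\<lambda>as. gen (as, [])) (lin project_left z)). fst x = []"
proof -
  let ?q = "\<lambda>y::'a cell. if snd y = [] then gen y else 0"
  have "lin (\<lambda>as. gen (as, [])) (lin project_left z) = lin ?q (lin cell_boundary z)"
    unfolding lin_lin using z by (intro lin_cong right_empty_part_of_boundary[symmetric]) blast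
  then have "lin cell_boundary z + lin (\<lambda>as. gen (as, [])) (lin project_left z) = lin (\<lambda>y. gen y
      + ?q y) (lin cell_boundary z)"
    by (simp only: lin_fun_add lin_gen_eq)
  moreover have "Poly_Mapping.keys (lin (\<lambda>y. gen y + ?q y) (lin cell_boundary z)) \<subseteq> {x. fst x = []}"
    using b by (intro keys_lin_subset) (auto simp: one_sided_def split: if_splits)
  ultimately show ?thesis by auto
qed

text \<open>\<open>project_left\<close> sends relative cycles to cycles. The two kinds of one-sided terms in \<open>\<partial> z\<close>
  have boundaries with empty right list and with empty left list. These boundaries cancel each
  other because \<open>\<partial> \<partial> z = 0\<close>, and for \<open>l \<ge> 2\<close> they have no cell in common.\<close>

lemma project_left_cycle:
  assumes z: "Poly_Mapping.keys z \<subseteq> bipartite_cells E (Suc l) - one_sided" and "l \<ge> 2"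
    and b: "Poly_Mapping.keys (lin cell_boundary z) \<subseteq> one_sided"
  shows "lin tuple_boundary (lin project_left z) = 0"
proof (rule ccontr)
  define v where "v = lin tuple_boundary (lin project_left z)"
  define \<iota> where "\<iota> = (\<lambda>as::'a list. gen (as, []::'a list))"
  define d where "d = lin cell_boundary z + lin \<iota> (lin project_left z)"
  assume "lin tuple_boundary (lin project_left z) \<noteq> 0"
  then have "Poly_Mapping.keys v \<noteq> {}" by (simp add: v_def)
  then obtain as where as: "as \<in> Poly_Mapping.keys v" by blast
  have "\<forall>x\<in>Poly_Mapping.keys d. fst x = []"
    unfolding d_def \<iota>_def using z b by (intro left_empty_after_correction) auto
  then have d0: "Poly_Mapping.keys (lin cell_boundary d) \<subseteq> {x. fst x = []}"
    by (intro keys_lin_subset) (auto dest!: keys_cell_boundary keys_tuple_boundary)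
  have "lin cell_boundary d = lin cell_boundary (lin \<iota> (lin project_left z))"
    by (simp add: d_def lin_add lin_lin cell_boundary_cell_boundary)
  also have "\<dots> = lin \<iota> v"
    by (simp add: v_def lin_lin \<iota>_def cell_boundary_def)
  finally have eq: "lin cell_boundary d = lin \<iota> v" .
  have "lin fst_gen (lin \<iota> v) = v" if "fst_gen = (\<lambda>x::'a cell. gen (fst x))" for fst_gen
    using that by (simp add: lin_lin \<iota>_def)
  then have "as \<in> Poly_Mapping.keys (lin (\<lambda>x::'a cell. gen (fst x)) (lin cell_boundary d))"
    using as eq by metis
  then have "as = []"
    using keys_lin[of "\<lambda>x::'a cell. gen (fst x)" "lin cell_boundary d"] d0 by auto
  moreover have "Poly_Mapping.keys v \<subseteq> {as. Suc (length as) = l}"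
  proof -
    have "Poly_Mapping.keys (lin project_left z) \<subseteq> {as. length as = l}"
      using z by (intro keys_lin_subset) (auto simp: project_left_def bipartite_cells_def)
    then show ?thesis
      unfolding v_def by (intro keys_lin_subset) (auto dest!: keys_tuple_boundary)
  qed
  ultimately show False using as \<open>l \<ge> 2\<close> by auto
qed

lemma cell_boundary_swap: "cell_boundary (prod.swap x) = swap_chain (cell_boundary x)"
  by (simp add: cell_boundary_def lin_add lin_lin add.commute)

lemma swap_swap_chain: "swap_chain (swap_chain z) = z"
  by (simp add: lin_lin)

lemma cell_boundary_swap_chain: "lin cell_boundary (swap_chain z) = swap_chain (lin cell_boundary z)"
  by (simp add: lin_lin cell_boundary_swap)

lemma keys_swap_chain:
  "Poly_Mapping.keys z \<subseteq> S \<Longrightarrow> (\<And>x. x \<in> S \<Longrightarrow> prod.swap x \<in> S) \<Longrightarrow> Poly_Mapping.keys (swap_chain z) \<subseteq> S"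
  by (rule keys_lin_subset) auto

text \<open>Lovasz' bound on the chain level. The hypothesis \<open>acyclic\<close> says that the reduced homology
  modulo 2 of the neighbourhood complex vanishes in dimensions \<open>0, \<dots>, k - 1\<close>; \<open>l\<close> is the number
  of vertices.\<close>

theorem acyclic_neighbourhood_complex_not_colourable:
  assumes sym: "\<And>a b. E a b \<Longrightarrow> E b a"
    and proper: "\<And>a b. E a b \<Longrightarrow> c a \<noteq> c b"
    and colours: "\<And>a b. E a b \<Longrightarrow> c a \<le> (k::nat)"
    and edge: "E a\<^sub>0 b\<^sub>0"
    and acyclic: "\<And>l z. 1 \<le> l \<Longrightarrow> l \<le> k \<Longrightarrow> Poly_Mapping.keys z \<subseteq> {xs. has_common_neighbour E xs \<and> length xs
        = l} \<Longrightarrow> lin tuple_boundary z = 0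
        \<Longrightarrow> \<exists>y. Poly_Mapping.keys y \<subseteq> {xs. has_common_neighbour E xs \<and> length xs = Suc l}
            \<and> lin tuple_boundary y = z"
  shows False
proof -
  have cell_proper: "c a \<noteq> c b" if "x \<in> bipartite_cells E l" "a \<in> set (fst x)" "b \<in> set (snd x)" for x a b l
    using that proper by (auto simp: bipartite_cells_def)
  have cell_colours: "c a \<le> k" if "x \<in> bipartite_cells E l" "a \<in> set (fst x) \<union> set (snd x)" for x a l
    using that by (auto simp: bipartite_cells_def has_common_neighbour_def intro: colours)
  have cells_swap: "prod.swap x \<in> bipartite_cells E l" if "x \<in> bipartite_cells E l" for x l
    using that by (auto simp: bipartite_cells_def intro: sym)
  have junk_swap: "prod.swap x \<in> one_sided \<longleftrightarrow> x \<in> one_sided" for x :: "'a cell"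
    by (auto simp: one_sided_def)
  have "\<exists>t. Poly_Mapping.keys t \<subseteq> bipartite_cells E l - one_sided
      \<and> Poly_Mapping.keys (lin cell_boundary (t + swap_chain t)) \<subseteq> one_sided
      \<and> lin tuple_boundary (lin project_left (t + swap_chain t)) = 0 \<and> lin (alternating_cochain c) (t
          + swap_chain t) = 1"
    if "2 \<le> l" "l \<le> k + 2" for l
    using that
  proof (induction l rule: dec_induct)
    case base
    \<comment> \<open>The chain with two vertices is one edge. Since the colours of its ends differ, exactly
      one of its two orientations has the vertex of smaller colour on the left.\<close>
    let ?t = "gen ([a\<^sub>0], [b\<^sub>0])"
    let ?z = "?t + swap_chain ?t"
    have z: "?z = gen ([a\<^sub>0], [b\<^sub>0]) + gen ([b\<^sub>0], [a\<^sub>0])" by simp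
    have cell: "([a\<^sub>0], [b\<^sub>0]) \<in> bipartite_cells E 2"
      using edge sym by (auto simp: bipartite_cells_def has_common_neighbour_def)
    have "Poly_Mapping.keys ?t \<subseteq> bipartite_cells E 2 - one_sided"
      using cell by (auto simp: one_sided_def)
    moreover have "Poly_Mapping.keys (lin cell_boundary ?z) \<subseteq> one_sided"
      unfolding z lin_add lin_gen
      by (intro keys_add_subset) (auto simp: one_sided_def dest!: keys_cell_boundary keys_tuple_boundary)
    moreover have "lin tuple_boundary (lin project_left ?z) = 0"
      by (simp add: z lin_add project_left_def)
    moreover have "lin (alternating_cochain c) ?z = 1"
    proof -
      have "alternating_cochain c ([a\<^sub>0], [b\<^sub>0]) + alternating_cochain c (prod.swap ([a\<^sub>0], [b\<^sub>0])) = 1"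
        unfolding alternating_cochain_swap[of "([a\<^sub>0], [b\<^sub>0])" c, OF cell_proper[OF cell]] 
        using proper[OF edge]
        by (auto simp: alternating_cochain_def signs_def signed_colours_def)
      then show ?thesis by (simp add: z lin_add)
    qed
    ultimately show ?case by blast
  next
    case (step l)
    then obtain t where t: "Poly_Mapping.keys t \<subseteq> bipartite_cells E l - one_sided"
      and bt: "Poly_Mapping.keys (lin cell_boundary (t + swap_chain t)) \<subseteq> one_sided"
      and lt: "lin tuple_boundary (lin project_left (t + swap_chain t)) = 0"
      and at: "lin (alternating_cochain c) (t + swap_chain t) = 1"
      by auto
    define z where "z = t + swap_chain t"
    have z: "Poly_Mapping.keys z \<subseteq> bipartite_cells E l - one_sided"
      unfolding z_def
    proof (rule keys_add_subset[OF t])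
      show "Poly_Mapping.keys (swap_chain t) \<subseteq> bipartite_cells E l - one_sided"
        using t by (rule keys_swap_chain) (auto simp: cells_swap junk_swap)
    qed
    have sz: "swap_chain z = z"
      by (simp only: z_def lin_add swap_swap_chain add.commute)
    have "Poly_Mapping.keys (lin project_left z) \<subseteq> {xs. has_common_neighbour E xs \<and> length xs = l - 1}"
      using z by (intro keys_lin_subset) (auto simp: project_left_def bipartite_cells_def)
    moreover have "1 \<le> l - 1" "l - 1 \<le> k" "Suc (l - 1) = l" using step by auto
    moreover have "lin tuple_boundary (lin project_left z) = 0" using lt by (simp add: z_def)
    ultimately obtain y where y: "Poly_Mapping.keys y \<subseteq> {xs. has_common_neighbour E xs \<and> length xs
        = l}" "lin tuple_boundary y = lin project_left z"
      using acyclic[of "l - 1" "lin project_left z"] by auto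
    define \<iota> where "\<iota> = (\<lambda>as::'a list. gen (as, []::'a list))"
    \<comment> \<open>Adding \<open>\<iota> y\<close> removes the terms with empty right list from the boundary of \<open>z\<close>; it is
      one-sided itself.\<close>
    have \<iota>y: "Poly_Mapping.keys (lin \<iota> y) \<subseteq> bipartite_cells E l \<inter> one_sided"
      using y(1) edge by (intro keys_lin_subset) (auto simp: \<iota>_def bipartite_cells_def
          has_common_neighbour_def one_sided_def)
    have b\<iota>y: "lin cell_boundary (lin \<iota> y) = lin \<iota> (lin project_left z)"
      by (simp add: lin_lin \<iota>_def cell_boundary_def flip: y(2))
    have "\<exists>w. Poly_Mapping.keys w \<subseteq> bipartite_cells E (Suc l)
        \<and> (\<forall>x\<in>Poly_Mapping.keys (lin cell_boundary w + (z + lin \<iota> y)). fst x = [])"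
    proof (rule fill_modulo_left_empty[OF sym])
      show "Poly_Mapping.keys (z + lin \<iota> y) \<subseteq> bipartite_cells E l"
        using z \<iota>y by (intro keys_add_subset) auto
      then show "\<forall>x\<in>Poly_Mapping.keys (z + lin \<iota> y). length (fst x) \<le> l"
        by (auto simp: bipartite_cells_def)
      show "\<forall>x\<in>Poly_Mapping.keys (lin cell_boundary (z + lin \<iota> y)). fst x = []"
        unfolding lin_add b\<iota>y unfolding \<iota>_def
        using z bt by (intro left_empty_after_correction) (auto simp: z_def)
    qed auto
    then obtain w where w: "Poly_Mapping.keys w \<subseteq> bipartite_cells E (Suc l)"
      "\<forall>x\<in>Poly_Mapping.keys (lin cell_boundary w + (z + lin \<iota> y)). fst x = []" by blast
    \<comment> \<open>The next chain is \<open>w\<close> without its one-sided cells, whose boundaries are one-sided and can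
      be ignored.\<close>
    define w' where "w' = lin (\<lambda>x. if x \<in> one_sided then 0 else gen x) w"
    define w'' where "w'' = lin (\<lambda>x. if x \<in> one_sided then gen x else 0) w"
    have ww: "w = w' + w''"
    proof -
      have "w' + w'' = lin (\<lambda>x. (if x \<in> one_sided then 0 else gen x)
          + (if x \<in> one_sided then gen x else 0)) w"
        by (simp only: w'_def w''_def lin_fun_add)
      also have "\<dots> = lin gen w" by (intro lin_cong) auto
      finally show ?thesis by simp
    qed
    have w': "Poly_Mapping.keys w' \<subseteq> bipartite_cells E (Suc l) - one_sided"
      unfolding w'_def using w by (intro keys_lin_subset) auto
    have w'': "Poly_Mapping.keys (lin cell_boundary w'') \<subseteq> one_sided"
    proof (rule keys_lin_subset)
      fix x assume "x \<in> Poly_Mapping.keys w''"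
      moreover have "Poly_Mapping.keys w'' \<subseteq> one_sided"
        unfolding w''_def by (intro keys_lin_subset) auto
      ultimately have "x \<in> one_sided" by blast
      then show "Poly_Mapping.keys (cell_boundary x) \<subseteq> one_sided"
        by (auto simp: one_sided_def dest!: keys_cell_boundary keys_tuple_boundary)
    qed
    define j where "j = lin cell_boundary w' + z"
    have "Poly_Mapping.keys (lin cell_boundary w + (z + lin \<iota> y)) \<subseteq> one_sided"
      using w(2) by (auto simp: one_sided_def)
    moreover have "Poly_Mapping.keys (lin \<iota> y + lin cell_boundary w'') \<subseteq> one_sided"
      using \<iota>y w'' by (intro keys_add_subset) auto
    ultimately have "Poly_Mapping.keys ((lin cell_boundary w + (z + lin \<iota> y)) + (lin \<iota> y
        + lin cell_boundary w'')) \<subseteq> one_sided"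
      by (rule keys_add_subset)
    then have j: "Poly_Mapping.keys j \<subseteq> one_sided"
      by (simp add: j_def ww lin_add ac_simps)
    have jc: "Poly_Mapping.keys j \<subseteq> bipartite_cells E l"
      unfolding j_def using w' z
      by (intro keys_add_subset keys_lin_subset) (auto dest: keys_cell_boundary_bipartite)
    have bw': "lin cell_boundary w' = z + j" by (simp add: j_def ac_simps)
    have bb: "lin cell_boundary (w' + swap_chain w') = j + swap_chain j"
    proof -
      have "lin cell_boundary (w' + swap_chain w') = (z + j) + swap_chain (z + j)"
        by (simp only: lin_add[of cell_boundary] cell_boundary_swap_chain bw')
      also have "swap_chain (z + j) = z + swap_chain j"
        by (simp only: lin_add sz)
      finally show ?thesis by (simp only: add.assoc add.left_commute[of j z] add_self_left)
    qed
    have b': "Poly_Mapping.keys (lin cell_boundary (w' + swap_chain w')) \<subseteq> one_sided"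
      unfolding bb
    proof (rule keys_add_subset[OF j])
      show "Poly_Mapping.keys (swap_chain j) \<subseteq> one_sided"
        using j by (rule keys_swap_chain) (simp add: junk_swap)
    qed
    have wsw: "Poly_Mapping.keys (w' + swap_chain w') \<subseteq> bipartite_cells E (Suc l) - one_sided"
    proof (rule keys_add_subset[OF w'])
      show "Poly_Mapping.keys (swap_chain w') \<subseteq> bipartite_cells E (Suc l) - one_sided"
        using w' by (rule keys_swap_chain) (auto simp: cells_swap junk_swap)
    qed
    have "lin (alternating_cochain c) (w' + swap_chain w') = lin (\<lambda>x. alternating_cochain c x
        + alternating_cochain c (prod.swap x)) w'"
      by (simp only: lin_add lin_fun_add lin_lin lin_gen)
    also have "\<dots> = lin (\<lambda>x. lin (alternating_cochain c) (cell_boundary x)) w'"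
    proof (rule lin_cong)
      fix x assume "x \<in> Poly_Mapping.keys w'"
      then have x: "x \<in> bipartite_cells E (Suc l)" using w' by auto
      show "alternating_cochain c x + alternating_cochain c (prod.swap x)
          = lin (alternating_cochain c) (cell_boundary x)"
        by (simp only: alternating_cochain_boundary alternating_cochain_swap[of x c, OF cell_proper[OF
            x]] alternating_cochain_def[of c x])
    qed
    also have "\<dots> = lin (alternating_cochain c) z + lin (alternating_cochain c) j"
      by (simp only: lin_lin[symmetric] bw' lin_add)
    also have "lin (alternating_cochain c) j = 0"
      using j jc step(1) by (intro lin_eq_0 alternating_cochain_one_sided) (auto simp: bipartite_cells_def)
    also have "lin (alternating_cochain c) z = 1" using at by (simp add: z_def)
    finally have "lin (alternating_cochain c) (w' + swap_chain w') = 1" by simp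
    moreover have "lin tuple_boundary (lin project_left (w' + swap_chain w')) = 0"
      using wsw step(1) b' by (rule project_left_cycle)
    ultimately show ?case using w' b' by blast
  qed
  from this[of "k + 2"] obtain t where
    t: "Poly_Mapping.keys t \<subseteq> bipartite_cells E (k + 2)" "lin (alternating_cochain c) (t + swap_chain t)
        = 1"
    by auto
  have "Poly_Mapping.keys (t + swap_chain t) \<subseteq> bipartite_cells E (k + 2)"
  proof (rule keys_add_subset[OF t(1)])
    show "Poly_Mapping.keys (swap_chain t) \<subseteq> bipartite_cells E (k + 2)"
      using t(1) by (rule keys_swap_chain) (rule cells_swap)
  qed
  moreover have "alternating_cochain c x = 0" if x: "x \<in> bipartite_cells E (k + 2)" for x
    using alternating_length_le[of True c x k] cell_proper[OF x] cell_colours[OF x] x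
    by (force simp: alternating_cochain_def bipartite_cells_def)
  ultimately have "lin (alternating_cochain c) (t + swap_chain t) = 0"
    by (intro lin_eq_0) auto
  then show False using t by simp
qed

section \<open>Extending maps from the boundary of a simplex\<close>

text \<open>If the homotopy set has only one element, the map and the constant map at its basepoint
  represent the same class.\<close>

lemma trivial_homotopy_group_nullhomotopic:
  assumes "trivial_homotopy_group p Y" and f: "continuous_map (nsphere p) Y f"
  obtains c where "homotopic_with (\<lambda>_. True) (nsphere p) Y f (\<lambda>_. c)"
proof -
  define y where "y = f sphere_basepoint"
  define R where "R = {(f, g). homotopic_with (\<lambda>h. h sphere_basepoint = y) (nsphere p) Y f g}"
  have "sphere_basepoint \<in> topspace (nsphere p)"
    unfolding sphere_basepoint_def by (rule in_topspace_nsphere)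
  then have y: "y \<in> topspace Y"
    using continuous_map_image_subset_topspace[OF f] by (auto simp: y_def)
  have "is_singleton (based_sphere_maps p Y y // R)"
    using assms(1) y by (simp add: trivial_homotopy_group_def homotopy_group_def R_def)
  moreover have "f \<in> based_sphere_maps p Y y" "(\<lambda>_. y) \<in> based_sphere_maps p Y y"
    using f y by (auto simp: based_sphere_maps_def y_def)
  ultimately have "R `` {f} = R `` {\<lambda>_. y}"
    by (metis is_singleton_def quotientI singletonD)
  moreover have "f \<in> R `` {f}"
    using f by (simp add: R_def y_def)
  ultimately have "homotopic_with (\<lambda>h. h sphere_basepoint = y) (nsphere p) Y (\<lambda>_. y) f"
    by (auto simp: R_def)
  from homotopic_with_symD[OF this] have "homotopic_with (\<lambda>_. True) (nsphere p) Y f (\<lambda>_. y)"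
    by (rule homotopic_with_mono) simp
  then show thesis by (rule that)
qed

lemma compact_space_nsphere: "compact_space (nsphere n)"
proof -
  let ?X = "powertop_real UNIV" and ?S = "{x::nat \<Rightarrow> real. (\<Sum>i\<le>n. (x i)\<^sup>2) = 1 \<and> (\<forall>i>n. x i = 0)}"
  have eq: "?S = {x \<in> topspace ?X. (\<Sum>i\<le>n. (x i)\<^sup>2) \<in> {1}} \<inter> (\<Inter>i\<in>{n<..}. {x \<in> topspace ?X. x i \<in> {0}})"
    by auto
  have sumsq: "continuous_map ?X euclideanreal (\<lambda>x. \<Sum>i\<le>n. (x i)\<^sup>2)"
    by (intro continuous_map_sum continuous_map_real_pow continuous_map_product_projection) auto
  have cl: "closedin ?X ?S"
    unfolding eq
    by (rule closedin_Int closedin_Inter sumsq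
             continuous_map_product_projection closedin_continuous_map_preimage | force | clarify)+
  have "?S \<subseteq> UNIV \<rightarrow>\<^sub>E {-1..1}"
  proof
    fix x assume x: "x \<in> ?S"
    have "\<bar>x i\<bar> \<le> 1" for i
    proof (cases "i \<le> n")
      case True
      then have "(x i)\<^sup>2 \<le> (\<Sum>i\<le>n. (x i)\<^sup>2)"
        by (intro member_le_sum) auto
      then show ?thesis using x by (simp add: abs_square_le_1)
    next
      case False
      then show ?thesis using x by auto
    qed
    then show "x \<in> UNIV \<rightarrow>\<^sub>E {-1..1}" by (auto simp: abs_le_iff PiE_def Pi_def)
  qed
  moreover have "compactin ?X (UNIV \<rightarrow>\<^sub>E {-1..1})"
    by (simp add: compactin_PiE)
  ultimately have "compactin ?X ?S"
    using cl closed_compactin by blast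
  then show ?thesis
    unfolding nsphere by (rule compact_space_subtopology)
qed

text \<open>The linear isomorphism from \<open>\<real>\<^sup>p\<^sup>+\<^sup>1\<close> to the hyperplane of coordinate sum 0 in \<open>\<real>\<^sup>p\<^sup>+\<^sup>2\<close>,
  that is, to the directions of the standard simplex of dimension \<open>p + 1\<close>.\<close>

definition zero_sum :: "nat \<Rightarrow> (nat \<Rightarrow> real) \<Rightarrow> nat \<Rightarrow> real" where
  "zero_sum p u = (\<lambda>i. if i \<le> p then u i else if i = Suc p then - (\<Sum>j\<le>p. u j) else 0)"

text \<open>The gauge that measures how fast the direction given by \<open>u\<close> leaves the simplex when one
  starts at the barycentre: it reaches the boundary after time \<open>1 / ((p + 2) * depth p u)\<close>.\<close>

definition depth :: "nat \<Rightarrow> (nat \<Rightarrow> real) \<Rightarrow> real" where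
  "depth p u = Max ((\<lambda>i. - zero_sum p u i) ` {..Suc p})"

text \<open>Polar coordinates of the simplex of dimension \<open>p + 1\<close>: the sphere is sent to the boundary
  at \<open>t = 0\<close> and to the barycentre at \<open>t = 1\<close>.\<close>

definition cone_map :: "nat \<Rightarrow> real \<times> (nat \<Rightarrow> real) \<Rightarrow> nat \<Rightarrow> real" where
  "cone_map p = (\<lambda>(t, u) i. if i \<le> Suc p
     then 1 / real (p + 2) + (1 - t) / (real (p + 2) * depth p u) * zero_sum p u i else 0)"

definition simplex_boundary :: "nat \<Rightarrow> (nat \<Rightarrow> real) set" where
  "simplex_boundary p = {x \<in> standard_simplex p. \<exists>i\<le>p. x i = 0}"

lemma sum_zero_sum: "(\<Sum>i\<le>Suc p. zero_sum p u i) = 0"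
  by (simp add: zero_sum_def)

lemma zero_sum_scale: "zero_sum p (\<lambda>i. r * u i) i = r * zero_sum p u i"
  by (simp add: zero_sum_def sum_distrib_left)

lemma depth_ge: "i \<le> Suc p \<Longrightarrow> - zero_sum p u i \<le> depth p u"
  unfolding depth_def by (intro Max_ge) auto

lemma depth_attained: obtains i where "i \<le> Suc p" "depth p u = - zero_sum p u i"
proof -
  have "depth p u \<in> (\<lambda>i. - zero_sum p u i) ` {..Suc p}"
    unfolding depth_def by (intro Max_in) auto
  then show thesis using that by auto
qed

lemma depth_pos:
  assumes "i \<le> Suc p" "zero_sum p u i \<noteq> 0"
  shows "depth p u > 0"
proof (rule ccontr)
  assume "\<not> depth p u > 0"
  then have "zero_sum p u j \<ge> 0" if "j \<le> Suc p" for j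
    using depth_ge[OF that, of u] by linarith
  then have "\<forall>j\<in>{..Suc p}. zero_sum p u j = 0"
    using sum_zero_sum[of p u] sum_nonneg_eq_0_iff[of "{..Suc p}" "zero_sum p u"] by auto
  then show False using assms by auto
qed

lemma depth_pos_nsphere:
  assumes "u \<in> topspace (nsphere p)"
  shows "depth p u > 0"
proof -
  have "\<exists>i\<le>p. u i \<noteq> 0"
  proof (rule ccontr)
    assume "\<not> (\<exists>i\<le>p. u i \<noteq> 0)"
    then have "(\<Sum>i\<le>p. (u i)\<^sup>2) = 0" by simp
    then show False using assms by (simp add: topspace_nsphere_iff)
  qed
  then obtain i where "i \<le> p" "u i \<noteq> 0" by blast
  then show ?thesis by (intro depth_pos[of i]) (auto simp: zero_sum_def)
qed

lemma depth_scale: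
  assumes "r > 0"
  shows "depth p (\<lambda>i. r * u i) = r * depth p u"
proof -
  have "depth p (\<lambda>i. r * u i) = Max ((\<lambda>x. r * x) ` ((\<lambda>i. - zero_sum p u i) ` {..Suc p}))"
    by (simp only: depth_def zero_sum_scale image_image mult_minus_right)
  also have "\<dots> = r * depth p u"
    unfolding depth_def using assms
    by (intro mono_Max_commute[symmetric]) (auto intro: monoI mult_left_mono)
  finally show ?thesis .
qed

lemma continuous_map_Max_atMost:
  assumes "\<And>i. i \<le> n \<Longrightarrow> continuous_map X euclideanreal (\<lambda>x. f x i)"
  shows "continuous_map X euclideanreal (\<lambda>x. Max (f x ` {..n::nat}))"
  using assms
proof (induction n)
  case (Suc n)
  have "Max (f x ` {..Suc n}) = max (f x (Suc n)) (Max (f x ` {..n}))" for x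
    by (simp add: atMost_Suc)
  then show ?case using Suc by (auto intro!: continuous_map_real_max)
qed simp

lemma continuous_map_zero_sum: "continuous_map (nsphere p) euclideanreal (\<lambda>u. zero_sum p u i)"
proof -
  consider "i \<le> p" | "i = Suc p" | "i > Suc p" by linarith
  then show ?thesis
  proof cases
    case 2
    then show ?thesis
      by (auto simp: zero_sum_def intro!: continuous_intros continuous_map_nsphere_projection)
  qed (auto simp: zero_sum_def continuous_map_nsphere_projection)
qed

lemma continuous_map_depth: "continuous_map (nsphere p) euclideanreal (depth p)"
  unfolding depth_def
  by (intro continuous_map_Max_atMost continuous_map_minus continuous_map_zero_sum)

lemma continuous_map_cone_map:
  "continuous_map (prod_topology (top_of_set {0..1}) (nsphere p)) (powertop_real UNIV) (cone_map p)"
proof -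
  let ?X = "prod_topology (top_of_set {0..1::real}) (nsphere p)"
  have fst: "continuous_map ?X euclideanreal fst"
    using continuous_map_fst continuous_map_into_fulltopology by blast
  have snd: "continuous_map ?X (nsphere p) snd" by (rule continuous_map_snd)
  have 1: "continuous_map ?X euclideanreal (\<lambda>z. zero_sum p (snd z) i)" for i
    using continuous_map_compose[OF snd continuous_map_zero_sum] by (simp add: comp_def)
  have 2: "continuous_map ?X euclideanreal (\<lambda>z. depth p (snd z))"
    using continuous_map_compose[OF snd continuous_map_depth] by (simp add: comp_def)
  have "depth p (snd z) \<noteq> 0" if "z \<in> topspace ?X" for z
    using that depth_pos_nsphere[of "snd z" p] by (auto simp del: topspace_subtopology)
  then have "continuous_map ?X euclideanreal (\<lambda>z. 1 / real (p + 2) + (1 - fst z) / (real (p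
      + 2) * depth p (snd z)) * zero_sum p (snd z) i)" for i
    by (intro continuous_intros fst 1 2) auto
  then have "continuous_map ?X euclideanreal (\<lambda>z. cone_map p z i)" for i
    by (cases "i \<le> Suc p") (simp_all add: cone_map_def case_prod_beta)
  then show ?thesis
    by (simp add: continuous_map_componentwise_UNIV)
qed

lemma cone_map_ge:
  assumes "u \<in> topspace (nsphere p)" "0 \<le> t" "t \<le> 1" "i \<le> Suc p"
  shows "cone_map p (t, u) i \<ge> t / real (p + 2)"
proof -
  define a where "a = (1 - t) / (real (p + 2) * depth p u)"
  have d: "depth p u > 0" using assms(1) by (rule depth_pos_nsphere)
  have "a \<ge> 0" using d assms by (simp add: a_def)
  then have "a * zero_sum p u i \<ge> a * - depth p u"
    using depth_ge[OF assms(4), of u] by (intro mult_left_mono) auto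
  also have "a * - depth p u = - ((1 - t) / real (p + 2))"
    using d by (simp add: a_def)
  finally have "1 / real (p + 2) + a * zero_sum p u i \<ge> 1 / real (p + 2) + - ((1 - t) / real (p + 2))"
      by linarith
  also have "1 / real (p + 2) + - ((1 - t) / real (p + 2)) = t / real (p + 2)"
    by (simp add: field_simps)
  finally show ?thesis using assms(4) by (simp add: cone_map_def a_def)
qed

lemma in_standard_simplexI:
  assumes "\<And>i. i \<le> p \<Longrightarrow> 0 \<le> x i" "\<And>i. i > p \<Longrightarrow> x i = 0" "(\<Sum>i\<le>p. x i) = 1"
  shows "x \<in> standard_simplex p"
proof -
  have "x i \<le> 1" if "i \<le> p" for i
    using assms member_le_sum[of i "{..p}" x] that by auto
  then show ?thesis
    using assms unfolding standard_simplex_def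
    by (auto; metis le_eq_less_or_eq nle_le not_less zero_le_one)
qed

lemma cone_map_in_simplex:
  assumes "u \<in> topspace (nsphere p)" "0 \<le> t" "t \<le> 1"
  shows "cone_map p (t, u) \<in> standard_simplex (Suc p)"
proof (rule in_standard_simplexI)
  show "0 \<le> cone_map p (t, u) i" if "i \<le> Suc p" for i
    using cone_map_ge[OF assms that] assms(2) by (meson divide_nonneg_nonneg of_nat_0_le_iff order_trans)
  define a where "a = (1 - t) / (real (p + 2) * depth p u)"
  have "(\<Sum>i\<le>Suc p. cone_map p (t, u) i) = (\<Sum>i\<le>Suc p. 1 / real (p + 2) + a * zero_sum p u i)"
    by (intro sum.cong) (auto simp: cone_map_def a_def)
  also have "\<dots> = 1 + a * (\<Sum>i\<le>Suc p. zero_sum p u i)"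
    unfolding sum.distrib sum_distrib_left by (simp add: field_simps del: sum.atMost_Suc)
  finally show "(\<Sum>i\<le>Suc p. cone_map p (t, u) i) = 1"
    unfolding sum_zero_sum by simp
qed (simp add: cone_map_def)

lemma cone_map_0_in_boundary:
  assumes "u \<in> topspace (nsphere p)"
  shows "cone_map p (0, u) \<in> simplex_boundary (Suc p)"
proof -
  obtain i where i: "i \<le> Suc p" "depth p u = - zero_sum p u i" by (rule depth_attained)
  then have z: "zero_sum p u i = - depth p u" by simp
  have "cone_map p (0, u) i = 0"
    using depth_pos_nsphere[OF assms] i(1) by (simp add: cone_map_def z)
  then show ?thesis
    using i(1) cone_map_in_simplex[OF assms, of 0] by (auto simp: simplex_boundary_def)
qed

lemma cone_map_boundary_imp_0:
  assumes "u \<in> topspace (nsphere p)" "0 \<le> t" "t \<le> 1" "cone_map p (t, u) \<in> simplex_boundary (Suc p)"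
  shows "t = 0"
proof -
  obtain i where "i \<le> Suc p" "cone_map p (t, u) i = 0"
    using assms(4) by (auto simp: simplex_boundary_def)
  then have "t / real (p + 2) \<le> 0" using cone_map_ge[OF assms(1-3)] by metis
  then show ?thesis using assms(2) by (simp add: field_simps)
qed

text \<open>Coordinates on the first \<open>p + 1\<close> axes determine \<open>u\<close> up to a nonnegative factor, and \<open>u\<close>
  has norm 1.\<close>

lemma cone_map_inj:
  assumes u: "u \<in> topspace (nsphere p)" "t \<le> 1" and v: "v \<in> topspace (nsphere p)" "s \<le> 1"
    and eq: "cone_map p (t, u) = cone_map p (s, v)"
  shows "t = s \<and> (t = 1 \<or> u = v)"
proof -
  define a where "a = (1 - t) / (real (p + 2) * depth p u)"
  define b where "b = (1 - s) / (real (p + 2) * depth p v)"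
  have d: "depth p u > 0" "depth p v > 0" using u v depth_pos_nsphere by auto
  have ab: "a \<ge> 0" "b \<ge> 0" using u v d by (auto simp: a_def b_def)
  have "a * u i = b * v i" if "i \<le> p" for i
    using fun_cong[OF eq, of i] that by (simp add: cone_map_def a_def b_def zero_sum_def)
  then have "(\<Sum>i\<le>p. (a * u i)\<^sup>2) = (\<Sum>i\<le>p. (b * v i)\<^sup>2)" by simp
  then have "a\<^sup>2 = b\<^sup>2"
    using u v by (simp add: power_mult_distrib topspace_nsphere_iff flip: sum_distrib_left)
  then have "a = b" using ab by simp
  show ?thesis
  proof (cases "a = 0")
    case True
    then show ?thesis using d \<open>a = b\<close> by (auto simp: a_def b_def)
  next
    case False
    have "u i = v i" for i
      using \<open>a = b\<close> False \<open>\<And>i. i \<le> p \<Longrightarrow> a * u i = b * v i\<close>[of i] u v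
      by (cases "i \<le> p") (auto simp: topspace_nsphere_iff)
    then have "u = v" by auto
    then show ?thesis using \<open>a = b\<close> d by (simp add: a_def b_def)
  qed
qed

text \<open>Normalise the first \<open>p + 1\<close> coordinates of the difference from the barycentre; if they
  vanish, the point is the barycentre.\<close>

lemma cone_map_surj:
  assumes x: "x \<in> standard_simplex (Suc p)"
  obtains t u where "u \<in> topspace (nsphere p)" "0 \<le> t" "t \<le> 1" "cone_map p (t, u) = x"
proof -
  define N where "N = real (p + 2)"
  have N: "N > 0" by (simp add: N_def)
  define y where "y = (\<lambda>i. if i \<le> p then x i - 1 / N else 0)"
  have zy: "zero_sum p y i = x i - 1 / N" if "i \<le> Suc p" for i
  proof (cases "i \<le> p")
    case False
    then have i: "i = Suc p" using that by simp
    have s: "(\<Sum>i\<le>p. x i) = 1 - x (Suc p)" using x by (simp add: standard_simplex_def)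
    have "(\<Sum>j\<le>p. y j) = 1 - x (Suc p) - (N - 1) / N"
      by (simp add: y_def sum_subtractf s) (simp add: N_def)
    also have "(N - 1) / N = 1 - 1 / N" using N by (simp add: diff_divide_distrib)
    finally show ?thesis by (simp add: zero_sum_def i)
  qed (simp add: zero_sum_def y_def)
  have x0: "x i = 0" if "i > Suc p" for i using x that by (simp add: standard_simplex_def)
  define r where "r = sqrt (\<Sum>i\<le>p. (y i)\<^sup>2)"
  show thesis
  proof (cases "r = 0")
    case True
    then have "(\<Sum>i\<le>p. (y i)\<^sup>2) = 0" by (simp add: r_def)
    then have "\<forall>i\<le>p. y i = 0" by (simp add: sum_nonneg_eq_0_iff)
    then have "zero_sum p y i = 0" for i by (simp add: zero_sum_def)
    then have x1: "x i = 1 / N" if "i \<le> Suc p" for i using zy[OF that] by simp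
    have "cone_map p (1, sphere_basepoint) = x"
      by (auto simp: cone_map_def x1 x0 N_def)
    then show thesis
      using that[of sphere_basepoint 1] in_topspace_nsphere[of p] by (simp add: sphere_basepoint_def)
  next
    case False
    then have r: "r > 0" by (simp add: r_def sum_nonneg order_less_le)
    define u where "u = (\<lambda>i. (1 / r) * y i)"
    have r2: "(\<Sum>i\<le>p. (y i)\<^sup>2) = r\<^sup>2" by (simp add: r_def sum_nonneg)
    have "(\<Sum>i\<le>p. (u i)\<^sup>2) = (1 / r)\<^sup>2 * (\<Sum>i\<le>p. (y i)\<^sup>2)"
      by (simp only: u_def power_mult_distrib sum_distrib_left)
    also have "\<dots> = 1" using r by (simp add: r2 field_simps)
    finally have u: "u \<in> topspace (nsphere p)"
      by (simp add: topspace_nsphere_iff) (simp add: u_def y_def)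
    have du: "depth p u = depth p y / r"
      unfolding u_def using depth_scale[of "1 / r" p y] r by simp
    then have dy: "depth p y > 0" using depth_pos_nsphere[OF u] r by (simp add: zero_less_divide_iff)
    define t where "t = 1 - N * depth p y"
    obtain i where i: "i \<le> Suc p" "depth p y = - zero_sum p y i" by (rule depth_attained)
    have "x i \<ge> 0" using x by (simp add: standard_simplex_def)
    then have "depth p y \<le> 1 / N" using i zy by simp
    then have t: "0 \<le> t" "t \<le> 1" using N dy by (auto simp: t_def field_simps)
    have "cone_map p (t, u) i = x i" for i
    proof (cases "i \<le> Suc p")
      case True
      have zu: "zero_sum p u i = zero_sum p y i / r"
        unfolding u_def zero_sum_scale by simp
      have "(1 - t) / (N * depth p u) * zero_sum p u i = zero_sum p y i"
        using N dy r by (simp add: du zu t_def)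
      then show ?thesis using True zy[OF True] by (simp add: cone_map_def N_def)
    qed (simp add: cone_map_def x0)
    then show thesis using that[OF u t] by auto
  qed
qed

text \<open>In polar coordinates a nullhomotopy of \<open>g\<close> on the boundary is a map on the whole simplex,
  since it is constant where the coordinates are not unique. Continuity follows because the
  coordinate map, going from a compact space to a Hausdorff one, is a quotient map.\<close>

proposition extend_from_simplex_boundary:
  assumes triv: "trivial_homotopy_group p Y"
    and g: "continuous_map (subtopology (powertop_real UNIV) (simplex_boundary (Suc p))) Y g"
  obtains G where "continuous_map (subtopology (powertop_real UNIV) (standard_simplex (Suc p))) Y G"
    "\<And>x. x \<in> simplex_boundary (Suc p) \<Longrightarrow> G x = g x"
proof -
  let ?P = "prod_topology (top_of_set {0..1::real}) (nsphere p)"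
  let ?D = "subtopology (powertop_real UNIV) (standard_simplex (Suc p))"
  have P: "(t, u) \<in> topspace ?P \<longleftrightarrow> u \<in> topspace (nsphere p) \<and> 0 \<le> t \<and> t \<le> 1" for t u
    by auto
  have cr: "continuous_map ?P ?D (cone_map p)"
    using continuous_map_cone_map cone_map_in_simplex
    by (auto simp: continuous_map_in_subtopology)
  have "quotient_map ?P ?D (cone_map p)"
  proof (rule continuous_imp_quotient_map[OF cr])
    show "compact_space ?P"
      by (simp add: compact_space_prod_topology compact_space_nsphere compact_space_subtopology)
    show "Hausdorff_space ?D"
      by (simp add: Hausdorff_space_subtopology Hausdorff_space_product_topology)
    show "cone_map p ` topspace ?P = topspace ?D"
    proof
      show "cone_map p ` topspace ?P \<subseteq> topspace ?D"
        using cr continuous_map_image_subset_topspace by blast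
      show "topspace ?D \<subseteq> cone_map p ` topspace ?P"
      proof
        fix x assume "x \<in> topspace ?D"
        then have "x \<in> standard_simplex (Suc p)" by simp
        then obtain t u where "u \<in> topspace (nsphere p)" "0 \<le> t" "t \<le> 1" "cone_map p (t, u) = x"
          by (rule cone_map_surj)
        then show "x \<in> cone_map p ` topspace ?P" using P by (metis imageI)
      qed
    qed
  qed
  moreover have "continuous_map (nsphere p) Y (\<lambda>u. g (cone_map p (0, u)))"
  proof -
    have "continuous_map (nsphere p) ?P (\<lambda>u. (0, u))"
      by (intro continuous_map_pairedI) auto
    then have "continuous_map (nsphere p) (powertop_real UNIV) (cone_map p \<circ> (\<lambda>u. (0, u)))"
      using continuous_map_cone_map by (rule continuous_map_compose)
    then have "continuous_map (nsphere p) (subtopology (powertop_real UNIV) (simplex_boundary (Suc p)))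
        (cone_map p \<circ> (\<lambda>u. (0, u)))"
      using cone_map_0_in_boundary by (auto simp: continuous_map_in_subtopology)
    from continuous_map_compose[OF this g] show ?thesis by (simp add: comp_def)
  qed
  then obtain c where "homotopic_with (\<lambda>_. True) (nsphere p) Y (\<lambda>u. g (cone_map p (0, u))) (\<lambda>_. c)"
    using trivial_homotopy_group_nullhomotopic[OF triv] by blast
  then obtain h where h: "continuous_map ?P Y h" "\<And>u. h (0, u) = g (cone_map p (0, u))" "\<And>u. h (1, u) = c"
    unfolding homotopic_with_def by auto
  define sec where "sec x = (SOME z. z \<in> topspace ?P \<and> cone_map p z = x)" for x
  define G where "G x = h (sec x)" for x
  have Gr: "G (cone_map p z) = h z" if z: "z \<in> topspace ?P" for z
  proof -
    have s: "sec (cone_map p z) \<in> topspace ?P" "cone_map p (sec (cone_map p z)) = cone_map p z"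
      using someI[of "\<lambda>w. w \<in> topspace ?P \<and> cone_map p w = cone_map p z" z] z
      unfolding sec_def by auto
    obtain t u t' u' where tu: "z = (t, u)" "sec (cone_map p z) = (t', u')" by fastforce
    have "t' = t \<and> (t' = 1 \<or> u' = u)"
    proof (rule cone_map_inj)
      show "u' \<in> topspace (nsphere p)" "t' \<le> 1" using s(1) unfolding tu(2) P by auto
      show "u \<in> topspace (nsphere p)" "t \<le> 1" using z unfolding tu(1) P by auto
      show "cone_map p (t', u') = cone_map p (t, u)" using s(2) tu by metis
    qed
    then show ?thesis using h(3) tu by (auto simp: G_def)
  qed
  have "continuous_map ?P Y (G \<circ> cone_map p)"
    by (rule continuous_map_eq[OF h(1)]) (simp only: Gr comp_def)
  ultimately have "continuous_map ?D Y G"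
    by (rule continuous_compose_quotient_map)
  moreover have "G x = g x" if x: "x \<in> simplex_boundary (Suc p)" for x
  proof -
    have "x \<in> standard_simplex (Suc p)" using x by (simp add: simplex_boundary_def)
    then obtain t u where tu: "u \<in> topspace (nsphere p)" "0 \<le> t" "t \<le> 1" "cone_map p (t, u) = x"
      by (rule cone_map_surj)
    then have "t = 0" using x cone_map_boundary_imp_0 by metis
    then show ?thesis using Gr[of "(t, u)"] tu h(2) P by metis
  qed
  ultimately show thesis by (rule that)
qed

section \<open>Filling spheres of singular simplices\<close>

text \<open>Drops the \<open>j\<close>-th coordinate; on the \<open>j\<close>-th face of the simplex this is the inverse of
  \<^const>\<open>simplical_face\<close>.\<close>

definition collapse :: "nat \<Rightarrow> (nat \<Rightarrow> real) \<Rightarrow> nat \<Rightarrow> real" where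
  "collapse j x = (\<lambda>i. if i < j then x i else x (Suc i))"

lemma collapse_simplical_face [simp]: "collapse j (simplical_face j x) = x"
  by (auto simp: collapse_def simplical_face_def)

lemma simplical_face_collapse:
  "x j = 0 \<Longrightarrow> simplical_face j (collapse j x) = x"
  by (auto simp: collapse_def simplical_face_def fun_eq_iff)

lemma collapse_collapse: "i < j \<Longrightarrow> collapse i (collapse j x) = collapse (j - 1) (collapse i x)"
  by (auto simp: collapse_def fun_eq_iff)

lemma collapse_in_standard_simplex:
  assumes x: "x \<in> standard_simplex (Suc p)" "x j = 0" and j: "j \<le> Suc p"
  shows "collapse j x \<in> standard_simplex p"
proof (rule in_standard_simplexI)
  have "(\<Sum>i\<le>p. collapse j x i) = (\<Sum>i\<le>Suc p. simplical_face j (collapse j x) i)"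
    using sum.zero_middle[of "Suc p" j "collapse j x" "collapse j x"] j
    by (simp add: simplical_face_def cong: if_cong)
  then show "(\<Sum>i\<le>p. collapse j x i) = 1"
    using x by (simp only: simplical_face_collapse) (simp add: standard_simplex_def)
qed (use x j in \<open>auto simp: collapse_def standard_simplex_def\<close>)

text \<open>The given simplices agree on the intersections of the faces, hence paste to a map on the
  boundary, which extends. This is the form in which vanishing homotopy is used to build
  simplices one dimension at a time.\<close>

proposition singular_simplex_with_faces:
  assumes triv: "trivial_homotopy_group p Y"
    and \<tau>: "\<And>j. j \<le> Suc p \<Longrightarrow> singular_simplex p Y (\<tau> j)"
    and compat: "\<And>i j. \<lbrakk>i < j; j \<le> Suc p; 1 \<le> p\<rbrakk> \<Longrightarrow>
                   singular_face p i (\<tau> j) = singular_face p (j - 1) (\<tau> i)"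
  obtains \<rho> where "singular_simplex (Suc p) Y \<rho>"
    "\<And>j. j \<le> Suc p \<Longrightarrow> singular_face (Suc p) j \<rho> = \<tau> j"
proof -
  let ?R = "powertop_real UNIV"
  let ?B = "subtopology ?R (simplex_boundary (Suc p))"
  define F where "F j = {x \<in> simplex_boundary (Suc p). x j = 0}" for j
  have FS: "x \<in> standard_simplex (Suc p)" "x j = 0" if "x \<in> F j" for x j
    using that by (auto simp: F_def simplex_boundary_def)
  have agree: "\<tau> i (collapse i x) = \<tau> j (collapse j x)"
    if ij: "i < j" "j \<le> Suc p" and x: "x \<in> F i" "x \<in> F j" for i j x
  proof (cases "p = 0")
    case True
    then have "i = 0" "j = 1" using ij by auto
    then show ?thesis using FS[OF x(1)] FS[OF x(2)] True by (simp add: standard_simplex_def)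
  next
    case False
    define z where "z = collapse i (collapse j x)"
    have cj: "collapse j x \<in> standard_simplex p" using FS[OF x(2)] ij
        by (intro collapse_in_standard_simplex) auto
    have cj0: "collapse j x i = 0" using ij FS[OF x(1)] by (simp add: collapse_def)
    have z: "z \<in> standard_simplex (p - 1)"
      unfolding z_def using collapse_in_standard_simplex[of "collapse j x" "p - 1" i] cj cj0 ij False
          by simp
    have 1: "simplical_face i z = collapse j x"
      unfolding z_def using cj0 by (rule simplical_face_collapse)
    have "z = collapse (j - 1) (collapse i x)"
      unfolding z_def using ij(1) by (rule collapse_collapse)
    moreover have "collapse i x (j - 1) = 0"
      using ij FS[OF x(2)] by (simp add: collapse_def)
    ultimately have 2: "simplical_face (j - 1) z = collapse i x"
      by (simp add: simplical_face_collapse)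
    have "singular_face p i (\<tau> j) z = singular_face p (j - 1) (\<tau> i) z"
      using compat[OF ij] False by simp
    then show ?thesis
      using z 1 2 by (simp add: singular_face_def)
  qed
  have "\<exists>g. continuous_map ?B Y g \<and> (\<forall>i x. i \<le> Suc p \<and> x \<in> F i \<longrightarrow> g x = \<tau> i (collapse i x))"
  proof (rule pasting_lemma_exists_closed[of "{..Suc p}" ?B F Y "\<lambda>j x. \<tau> j (collapse j x)"])
    show "topspace ?B \<subseteq> \<Union> (F ` {..Suc p})"
      by (auto simp: F_def simplex_boundary_def)
    show "closedin ?B (F i)" if "i \<in> {..Suc p}" for i
    proof -
      have "F i = {x \<in> topspace ?R. x i \<in> {0}} \<inter> simplex_boundary (Suc p)"
        by (auto simp: F_def)
      moreover have "closedin ?R {x \<in> topspace ?R. x i \<in> {0}}"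
        by (rule closedin_continuous_map_preimage[OF continuous_map_product_projection]) auto
      ultimately show ?thesis by (auto simp: closedin_subtopology)
    qed
    show "continuous_map (subtopology ?B (F i)) Y (\<lambda>x. \<tau> i (collapse i x))" if i: "i \<in> {..Suc p}" for i
    proof -
      have "continuous_map ?R ?R (collapse i)"
        unfolding collapse_def continuous_map_componentwise_UNIV
        by (auto intro: continuous_map_product_projection)
      then have "continuous_map (subtopology ?B (F i)) (subtopology ?R (standard_simplex p)) (collapse i)"
        using i FS by (auto simp: continuous_map_in_subtopology subtopology_subtopology
            intro!: continuous_map_from_subtopology collapse_in_standard_simplex)
      moreover have "continuous_map (subtopology ?R (standard_simplex p)) Y (\<tau> i)"
        using \<tau>[of i] i by (simp add: singular_simplex_def)
      ultimately show ?thesis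
        using continuous_map_compose by (fastforce simp: comp_def)
    qed
    show "\<tau> i (collapse i x) = \<tau> j (collapse j x)"
      if "i \<in> {..Suc p}" "j \<in> {..Suc p}" "x \<in> topspace ?B \<inter> F i \<inter> F j" for i j x
    proof (cases i j rule: linorder_cases)
      case less
      then show ?thesis by (rule agree) (use that in auto)
    next
      case greater
      then show ?thesis by (rule agree[symmetric]) (use that in auto)
    qed simp
    show ?thesis if "continuous_map ?B Y g" 
      "\<And>x i. i \<in> {..Suc p} \<Longrightarrow> x \<in> topspace ?B \<inter> F i \<Longrightarrow> g x = \<tau> i (collapse i x)" for g
      using that by (intro exI[of _ g]) (auto simp: F_def)
  qed auto
  then obtain g where g: "continuous_map ?B Y g" "\<And>i x. i \<le> Suc p \<Longrightarrow> x \<in> F i \<Longrightarrow> g x = \<tau> i (collapse i x)"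
    by blast
  obtain G where G: "continuous_map (subtopology ?R (standard_simplex (Suc p))) Y G"
    "\<And>x. x \<in> simplex_boundary (Suc p) \<Longrightarrow> G x = g x"
    using extend_from_simplex_boundary[OF triv g(1)] by blast
  define \<rho> where "\<rho> = restrict G (standard_simplex (Suc p))"
  have "singular_simplex (Suc p) Y \<rho>"
    using G(1) by (simp add: singular_simplex_def \<rho>_def)
  moreover have "singular_face (Suc p) j \<rho> = \<tau> j" if j: "j \<le> Suc p" for j
  proof
    fix z
    show "singular_face (Suc p) j \<rho> z = \<tau> j z"
    proof (cases "z \<in> standard_simplex p")
      case True
      have f: "simplical_face j z \<in> standard_simplex (Suc p)"
        using simplical_face_in_standard_simplex[of "Suc p" j z] True j by simp
      then have F: "simplical_face j z \<in> F j"
        using j by (auto simp: F_def simplex_boundary_def simplical_face_def intro!: exI[of _ j])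
      then have "G (simplical_face j z) = g (simplical_face j z)"
        by (intro G(2)) (simp add: F_def)
      then show ?thesis using True f g(2)[OF j F] by (simp add: singular_face_def \<rho>_def)
    next
      case False
      then show ?thesis
        using \<tau>[OF j] by (auto simp: singular_face_def singular_simplex_def extensional_def)
    qed
  qed
  ultimately show thesis by (rule that)
qed

section \<open>Simplices of the geometric realization\<close>

text \<open>On a closed simplex of the complex, the coherent topology is no finer than the product
  topology.\<close>

lemma continuous_map_geometric_realization:
  assumes "\<sigma> \<in> K" "continuous_map Z (powertop_real UNIV) f" "f ` topspace Z \<subseteq> closed_simplex \<sigma>"
  shows "continuous_map Z (geometric_realization K) f"
  unfolding continuous_map_def
proof (intro conjI allI impI)
  show "f \<in> topspace Z \<rightarrow> topspace (geometric_realization K)"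
    using assms by auto
  fix U assume "openin (geometric_realization K) U"
  then have "openin (subtopology (powertop_real UNIV) (closed_simplex \<sigma>)) (U \<inter> closed_simplex \<sigma>)"
    using assms(1) by (simp add: openin_geometric_realization)
  moreover have "continuous_map Z (subtopology (powertop_real UNIV) (closed_simplex \<sigma>)) f"
    using assms by (simp add: continuous_map_in_subtopology image_subset_iff_funcset)
  ultimately have "openin Z {x \<in> topspace Z. f x \<in> U \<inter> closed_simplex \<sigma>}"
    using openin_continuous_map_preimage by blast
  moreover have "{x \<in> topspace Z. f x \<in> U \<inter> closed_simplex \<sigma>} = {x \<in> topspace Z. f x \<in> U}"
    using assms(3) by auto
  ultimately show "openin Z {x \<in> topspace Z. f x \<in> U}" by simp
qed

text \<open>The affine singular simplex with the given vertices, in barycentric coordinates.\<close>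

definition spanned :: "'a list \<Rightarrow> (nat \<Rightarrow> real) \<Rightarrow> 'a \<Rightarrow> real" where
  "spanned xs = oriented_simplex (length xs - 1) (\<lambda>i v. of_bool (xs ! i = v))"

lemma spanned_in_closed_simplex:
  assumes "xs \<noteq> []" "x \<in> standard_simplex (length xs - 1)"
  shows "spanned xs x \<in> closed_simplex (set xs)"
proof -
  let ?p = "length xs - 1"
  have eq: "spanned xs x v = (\<Sum>j\<le>?p. of_bool (xs ! j = v) * x j)" for v
    using assms by (simp add: spanned_def oriented_simplex_def)
  have x: "x i \<ge> 0" "(\<Sum>i\<le>?p. x i) = 1" for i
    using assms by (auto simp: standard_simplex_def)
  have "(\<Sum>v\<in>set xs. spanned xs x v) = (\<Sum>j\<le>?p. \<Sum>v\<in>set xs. of_bool (xs ! j = v) * x j)"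
    unfolding eq by (rule sum.swap)
  also have "\<dots> = (\<Sum>j\<le>?p. x j)"
  proof (rule sum.cong[OF refl])
    fix j assume "j \<in> {..?p}"
    then have "j < length xs" using assms(1) by (cases xs) auto
    then have "xs ! j \<in> set xs" by (rule nth_mem)
    then show "(\<Sum>v\<in>set xs. of_bool (xs ! j = v) * x j) = x j"
      by (simp add: of_bool_def if_distrib[of "\<lambda>t. t * _"] cong: if_cong)
  qed
  finally have "sum (spanned xs x) (set xs) = 1" using x by simp
  moreover have "spanned xs x v = 0" if "v \<notin> set xs" for v
  proof -
    have "xs ! j \<noteq> v" if "j \<le> ?p" for j
    proof -
      have "j < length xs" using that assms(1) by (cases xs) auto
      then show ?thesis using \<open>v \<notin> set xs\<close> nth_mem by metis
    qed
    then show ?thesis by (simp add: eq)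
  qed
  ultimately show ?thesis
    unfolding closed_simplex_def by (auto simp: eq intro!: sum_nonneg x mult_nonneg_nonneg)
qed

lemma singular_simplex_spanned:
  assumes "set xs \<in> K" "xs \<noteq> []"
  shows "singular_simplex (length xs - 1) (subtopology (geometric_realization K) (closed_simplex (set
      xs))) (spanned xs)"
proof -
  let ?p = "length xs - 1"
  have im: "spanned xs ` standard_simplex ?p \<subseteq> closed_simplex (set xs)"
    using spanned_in_closed_simplex[OF assms(2)] by auto
  have "simplicial_simplex ?p UNIV (spanned xs)"
    unfolding simplicial_simplex by (auto simp: spanned_def)
  then have "singular_simplex ?p (powertop_real UNIV) (spanned xs)"
    by (simp add: simplicial_simplex_def)
  then show ?thesis
    unfolding singular_simplex_subtopology using im assms(1)
    by (auto simp: singular_simplex_def intro!: continuous_map_geometric_realization)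
qed

lemma nth_del: "j < length xs \<Longrightarrow> i < length xs - 1 \<Longrightarrow> del j xs ! i = (if i < j then xs ! i else xs ! Suc i)"
  by (auto simp: del_def nth_append min_def)

lemma singular_face_spanned:
  assumes "length xs \<ge> 2" "j < length xs"
  shows "singular_face (length xs - 1) j (spanned xs) = spanned (del j xs)"
proof -
  have "singular_face (length xs - 1) j (spanned xs) =
     oriented_simplex (length xs - 1 - 1) (\<lambda>i. if i < j then (\<lambda>v. of_bool (xs ! i
         = v)) else (\<lambda>v. of_bool (xs ! Suc i = v)))"
    unfolding spanned_def using assms by (subst singular_face_oriented_simplex) auto
  also have "\<dots> = spanned (del j xs)"
    unfolding spanned_def length_del[OF assms(2)]
    using assms by (subst oriented_simplex_eq) (auto simp: nth_del)
  finally show ?thesis .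
qed

lemma del_del:
  assumes "i < j" "j < length xs"
  shows "del i (del j xs) = del (j - 1) (del i xs)"
  using assms
proof (induction xs arbitrary: i j)
  case (Cons x xs)
  then obtain j' where "j = Suc j'" by (cases j) auto
  then show ?case using Cons.IH[of "i - 1" j'] Cons.prems by (cases i; cases j') auto
qed simp

text \<open>A vertex whose barycentric coordinate is largest. The choice is a discontinuous substitute
  for a simplicial approximation: it is made at the corners of small simplices only.\<close>

definition peak :: "('a \<Rightarrow> real) \<Rightarrow> 'a" where
  "peak x = (SOME v. \<forall>u. x u \<le> x v)"

lemma peak_max:
  assumes "x \<in> closed_simplex \<sigma>" "finite \<sigma>"
  shows "x u \<le> x (peak x)" "x (peak x) > 0" "peak x \<in> \<sigma>"
proof -
  have x: "\<And>v. 0 \<le> x v" "\<And>v. v \<notin> \<sigma> \<Longrightarrow> x v = 0" "sum x \<sigma> = 1"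
    using assms(1) by (auto simp: closed_simplex_def)
  then have "\<sigma> \<noteq> {}" by auto
  then obtain v where v: "v \<in> \<sigma>" "\<And>u. u \<in> \<sigma> \<Longrightarrow> x u \<le> x v"
    using Max_in[of "x ` \<sigma>"] Max_ge[of "x ` \<sigma>"] assms(2)
    by (metis (no_types, lifting) finite_imageI imageE imageI image_is_empty)
  have "\<forall>u. x u \<le> x v" using v x by metis
  then have p: "\<forall>u. x u \<le> x (peak x)" unfolding peak_def by (rule someI)
  then show "x u \<le> x (peak x)" by simp
  show "x (peak x) > 0"
  proof (rule ccontr)
    assume "\<not> x (peak x) > 0"
    then have "x u = 0" for u using p x(1)[of u] by (metis linorder_not_less order_antisym order_trans)
    then show False using x(3) by simp
  qed
  then show "peak x \<in> \<sigma>" using x(2) by force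
qed

text \<open>The corners of a singular simplex in the realization, each rounded to a vertex of the
  complex.\<close>

definition vertices :: "nat \<Rightarrow> ((nat \<Rightarrow> real) \<Rightarrow> 'a \<Rightarrow> real) \<Rightarrow> 'a list" where
  "vertices p f = map (\<lambda>i. peak (f (\<lambda>j. if j = i then 1 else 0))) [0..<Suc p]"

lemma length_vertices [simp]: "length (vertices p f) = Suc p"
  by (simp add: vertices_def)

lemma nth_vertices: "i \<le> p \<Longrightarrow> vertices p f ! i = peak (f (\<lambda>j. if j = i then 1 else 0))"
  by (simp add: vertices_def less_Suc_eq_le del: upt_Suc)

lemma vertices_spanned:
  assumes "xs \<noteq> []"
  shows "vertices (length xs - 1) (spanned xs) = xs"
proof (rule nth_equalityI)
  fix i assume "i < length (vertices (length xs - 1) (spanned xs))"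
  then have i: "i \<le> length xs - 1" by simp
  have "spanned xs (\<lambda>j. if j = i then 1 else 0) = (\<lambda>v. of_bool (xs ! i = v))"
    using i by (auto simp: spanned_def oriented_simplex_def fun_eq_iff if_distrib[of "\<lambda>t. _ * t"] cong:
        if_cong)
  moreover have "peak (\<lambda>v. of_bool (xs ! i = v)) = xs ! i"
    unfolding peak_def by (rule some_equality) (auto split: if_splits simp: of_bool_def dest: spec[of _
        "xs ! i"])
  ultimately show "vertices (length xs - 1) (spanned xs) ! i = xs ! i"
    using i by (simp add: nth_vertices)
qed (use assms in simp)

lemma vertices_singular_face:
  assumes "1 \<le> p" "j \<le> p"
  shows "vertices (p - 1) (singular_face p j f) = del j (vertices p f)"
proof (rule nth_equalityI)
  show "length (vertices (p - 1) (singular_face p j f)) = length (del j (vertices p f))"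
    using assms by simp
  fix i assume "i < length (vertices (p - 1) (singular_face p j f))"
  then have i: "i \<le> p - 1" by simp
  have "simplical_face j (\<lambda>l. if l = i then 1 else 0) = (\<lambda>l. if l
      = (if i < j then i else Suc i) then 1 else (0::real))"
    by (auto simp: simplical_face_def fun_eq_iff)
  then show "vertices (p - 1) (singular_face p j f) ! i = del j (vertices p f) ! i"
    using i assms by (simp add: nth_del nth_vertices singular_face_def)
qed

section \<open>Acyclicity of highly connected complexes\<close>

definition mod2 :: "('a \<Rightarrow>\<^sub>0 int) \<Rightarrow> 'a chain2" where
  "mod2 c = Poly_Mapping.map of_int c"

lemma lookup_mod2: "Poly_Mapping.lookup (mod2 c) x = of_int (Poly_Mapping.lookup c x)"
  by (simp add: mod2_def map.rep_eq when_def)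

lemma mod2_diff: "mod2 (a - b) = mod2 a + mod2 b"
proof -
  have "of_int (u - v) = (of_int u + of_int v :: bit)" for u v :: int
    by (metis add.left_neutral add_self diff_conv_add_uminus eq_iff_add_eq_0 minus_unique of_int_diff)
  then show ?thesis
    by (simp add: poly_mapping_eq_iff fun_eq_iff lookup_mod2 lookup_add lookup_minus del: add_bit_eq_xor
        of_int_diff)
qed

lemma mod2_0 [simp]: "mod2 0 = 0"
  by (simp add: poly_mapping_eq_iff fun_eq_iff lookup_mod2)

lemma mod2_frag_of [simp]: "mod2 (frag_of x) = gen x"
  by (simp add: poly_mapping_eq_iff fun_eq_iff lookup_mod2 lookup_single when_def)

lemma keys_mod2: "Poly_Mapping.keys (mod2 c) \<subseteq> Poly_Mapping.keys c"
  by (auto simp: in_keys_iff lookup_mod2)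

text \<open>Maps to a group of exponent 2 do not see the signs of a boundary.\<close>

lemma mod2_additive_alternating_sum:
  fixes F :: "('a \<Rightarrow>\<^sub>0 int) \<Rightarrow> 'b::elementary_two_group"
  assumes "\<And>a b. F (a - b) = F a + F b"
  shows "F (\<Sum>k\<in>I. frag_cmul ((-1) ^ k) (frag_of (s k))) = (\<Sum>k\<in>I. F (frag_of (s k)))"
proof -
  have 0: "F 0 = 0" using assms[of 0 0] by simp
  have minus: "F (- a) = F a" for a using assms[of 0 a] 0 by simp
  have add: "F (a + b) = F a + F b" for a b using assms[of a "- b"] minus by simp
  have cmul: "F (frag_cmul ((-1) ^ k) a) = F a" for k a
    by (cases "even k") (auto simp: minus)
  show ?thesis
    by (induction I rule: infinite_finite_induct) (auto simp: 0 add cmul)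
qed

definition vertex_chain :: "nat \<Rightarrow> ('a \<Rightarrow> real) chain \<Rightarrow> 'a list chain2" where
  "vertex_chain p c = lin (\<lambda>f. gen (vertices p f)) (mod2 c)"

lemma vertex_chain_diff: "vertex_chain p (a - b) = vertex_chain p a + vertex_chain p b"
  by (simp add: vertex_chain_def mod2_diff lin_add)

lemma vertex_chain_0 [simp]: "vertex_chain p 0 = 0"
  by (simp add: vertex_chain_def)

lemma vertex_chain_frag_of [simp]: "vertex_chain p (frag_of f) = gen (vertices p f)"
  by (simp add: vertex_chain_def)

lemma keys_vertex_chain:
  "Poly_Mapping.keys (vertex_chain p c) \<subseteq> vertices p ` Poly_Mapping.keys c"
  unfolding vertex_chain_def using keys_mod2[of c] by (intro keys_lin_subset) auto

text \<open>Rounding acts on each corner separately, so it commutes with faces. It is therefore a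
  chain map on all singular chains; smallness matters only for the result to consist of
  simplices of the complex.\<close>

lemma tuple_boundary_vertex_chain:
  assumes "1 \<le> p"
  shows "lin tuple_boundary (vertex_chain p c) = vertex_chain (p - 1) (chain_boundary p c)"
proof -
  have "Poly_Mapping.keys c \<subseteq> UNIV" by simp
  then show ?thesis
  proof (induction c rule: frag_induction)
    case (one f)
    have "lin tuple_boundary (vertex_chain p (frag_of f)) = (\<Sum>j\<le>p. gen (del j (vertices p f)))"
      by (simp add: tuple_boundary_eq_sum lessThan_Suc_atMost)
    also have "\<dots> = (\<Sum>j\<le>p. vertex_chain (p - 1) (frag_of (singular_face p j f)))"
      using assms vertices_singular_face[of p _ f] by (intro sum.cong) (auto simp del: One_nat_def)
    also have "\<dots> = vertex_chain (p - 1) (chain_boundary p (frag_of f))"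
      using assms by (simp add: chain_boundary_of mod2_additive_alternating_sum[of "vertex_chain _", OF
          vertex_chain_diff] del: vertex_chain_frag_of)
    finally show ?case .
  qed (auto simp: vertex_chain_diff chain_boundary_diff lin_add)
qed

lemma vertices_subset:
  assumes "\<And>x. x \<in> standard_simplex p \<Longrightarrow> peak (f x) \<in> S"
  shows "set (vertices p f) \<subseteq> S"
  using assms by (auto simp: vertices_def less_Suc_eq_le simp del: upt_Suc)

locale simplicial_complex =
  fixes K :: "'a set set"
  assumes finite_simplex: "\<sigma> \<in> K \<Longrightarrow> finite \<sigma>"
    and face_closed: "\<sigma> \<in> K \<Longrightarrow> \<tau> \<subseteq> \<sigma> \<Longrightarrow> \<tau> \<noteq> {} \<Longrightarrow> \<tau> \<in> K"
    and nonempty: "K \<noteq> {}"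
    and simplex_nonempty: "{} \<notin> K"
begin

abbreviation X where "X \<equiv> geometric_realization K"

text \<open>The empty list is the simplex of dimension \<open>-1\<close> of the augmented complex.\<close>

definition ordered_simplex :: "'a list \<Rightarrow> bool" where
  "ordered_simplex xs \<longleftrightarrow> xs = [] \<or> set xs \<in> K"

lemma ordered_simplex_mono: "ordered_simplex xs \<Longrightarrow> set ys \<subseteq> set xs \<Longrightarrow> ordered_simplex ys"
  using face_closed by (auto simp: ordered_simplex_def)

lemma ordered_simplex_del: "ordered_simplex xs \<Longrightarrow> ordered_simplex (del j xs)"
  using ordered_simplex_mono set_del by metis

lemma spanned_in_X:
  assumes "ordered_simplex xs" "xs \<noteq> []"
  shows "singular_simplex (length xs - 1) X (spanned xs)"
  using singular_simplex_spanned[of xs K] assms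
  by (auto simp: ordered_simplex_def singular_simplex_subtopology)

text \<open>\<open>D xs\<close> is a cone over the affine simplex on \<open>xs\<close>: its first face is the base, and the
  other faces are the chosen cones over the faces of the base. The cone over the empty list is
  the apex.\<close>

definition is_cone :: "('a list \<Rightarrow> (nat \<Rightarrow> real) \<Rightarrow> 'a \<Rightarrow> real) \<Rightarrow> 'a list \<Rightarrow> bool" where
  "is_cone D xs \<longleftrightarrow> singular_simplex (length xs) X (D xs) \<and>
     (xs \<noteq> [] \<longrightarrow> singular_face (length xs) 0 (D xs) = spanned xs) \<and>
     (\<forall>j<length xs. singular_face (length xs) (Suc j) (D xs) = D (del j xs))"

text \<open>By induction on the dimension: the base and the cones already chosen over its faces form a
  compatible family, which is filled by the vanishing of the next homotopy group.\<close>

lemma cones_exist: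
  assumes "\<And>p. p < m \<Longrightarrow> trivial_homotopy_group p X"
  shows "\<exists>D. \<forall>xs. ordered_simplex xs \<and> length xs \<le> m \<longrightarrow> is_cone D xs"
  using assms
proof (induction m)
  case 0
  obtain \<sigma> v where "\<sigma> \<in> K" "v \<in> \<sigma>" using nonempty simplex_nonempty by fastforce
  then have "ordered_simplex [v]" using face_closed[of \<sigma> "{v}"] by (simp add: ordered_simplex_def)
  from spanned_in_X[OF this]
  have "singular_simplex 0 X (spanned [v])" by simp
  then show ?case by (intro exI[of _ "\<lambda>_. spanned [v]"]) (simp add: is_cone_def)
next
  case (Suc m)
  then obtain D where "\<forall>xs. ordered_simplex xs \<and> length xs \<le> m \<longrightarrow> is_cone D xs" by fastforce
  then have D: "\<And>xs. ordered_simplex xs \<Longrightarrow> length xs \<le> m \<Longrightarrow> singular_simplex (length xs) X (D xs)"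
    "\<And>xs. ordered_simplex xs \<Longrightarrow> length xs \<le> m \<Longrightarrow> xs \<noteq> [] \<Longrightarrow> singular_face (length xs) 0 (D xs) = spanned xs"
    "\<And>xs j. ordered_simplex xs \<Longrightarrow> length xs \<le> m \<Longrightarrow> j < length xs
        \<Longrightarrow> singular_face (length xs) (Suc j) (D xs) = D (del j xs)"
    by (simp_all add: is_cone_def)
  have ex: "\<exists>\<rho>. singular_simplex (Suc m) X \<rho> \<and> singular_face (Suc m) 0 \<rho> = spanned xs \<and>
      (\<forall>j<Suc m. singular_face (Suc m) (Suc j) \<rho> = D (del j xs))"
    if xs: "ordered_simplex xs" "length xs = Suc m" for xs
  proof -
    define \<tau> where "\<tau> j = (case j of 0 \<Rightarrow> spanned xs | Suc j \<Rightarrow> D (del j xs))" for j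
    have ne: "xs \<noteq> []" using xs by auto
    have dl: "length (del j xs) = m" if "j < Suc m" for j using that xs by simp
    have "singular_simplex m X (\<tau> j)" if "j \<le> Suc m" for j
    proof (cases j)
      case 0
      then show ?thesis using spanned_in_X[OF xs(1) ne] xs(2) by (simp add: \<tau>_def)
    next
      case (Suc j')
      then show ?thesis using D(1)[of "del j' xs"] dl[of j'] ordered_simplex_del[OF xs(1)] that
          by (simp add: \<tau>_def)
    qed
    moreover have "singular_face m i (\<tau> j) = singular_face m (j - 1) (\<tau> i)"
      if ij: "i < j" "j \<le> Suc m" "1 \<le> m" for i j
    proof -
      obtain j' where j: "j = Suc j'" using ij by (cases j) auto
      have j': "j' < Suc m" using ij j by simp
      have dne: "del j' xs \<noteq> []" using dl[OF j'] ij by auto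
      show ?thesis
      proof (cases i)
        case 0
        have "singular_face m 0 (D (del j' xs)) = spanned (del j' xs)"
          using D(2)[of "del j' xs"] dne dl[OF j'] ordered_simplex_del[OF xs(1)] by simp
        also have "\<dots> = singular_face m j' (spanned xs)"
          using singular_face_spanned[of xs j'] xs(2) j' ij by simp
        finally show ?thesis by (simp add: \<tau>_def j 0)
      next
        case (Suc i')
        have i': "i' < j'" using Suc ij j by simp
        then have "i' < Suc m" using j' by simp
        have "singular_face m (Suc i') (D (del j' xs)) = D (del i' (del j' xs))"
          using D(3)[of "del j' xs" i'] dl[OF j'] ordered_simplex_del[OF xs(1)] i' j' by simp
        also have "\<dots> = D (del (j' - 1) (del i' xs))"
          using del_del[OF i', of xs] j' xs(2) by simp
        also have "\<dots> = singular_face m (Suc (j' - 1)) (D (del i' xs))"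
          using D(3)[of "del i' xs" "j' - 1"] dl[OF \<open>i' < Suc m\<close>] ordered_simplex_del[OF xs(1)] i' j'
              by simp
        finally show ?thesis using i' by (simp add: \<tau>_def j Suc)
      qed
    qed
    ultimately obtain \<rho> where \<rho>: "singular_simplex (Suc m) X \<rho>"
      "\<And>j. j \<le> Suc m \<Longrightarrow> singular_face (Suc m) j \<rho> = \<tau> j"
      using singular_simplex_with_faces[OF Suc.prems[OF lessI], of \<tau>] by blast
    then show ?thesis by (intro exI[of _ \<rho>]) (auto simp: \<tau>_def)
  qed
  then obtain \<rho> where \<rho>: "\<And>xs. ordered_simplex xs \<Longrightarrow> length xs = Suc m \<Longrightarrow> singular_simplex (Suc m) X (\<rho> xs)"
     "\<And>xs. ordered_simplex xs \<Longrightarrow> length xs = Suc m \<Longrightarrow> singular_face (Suc m) 0 (\<rho> xs) = spanned xs"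
     "\<And>xs j. ordered_simplex xs \<Longrightarrow> length xs = Suc m \<Longrightarrow> j < Suc m \<Longrightarrow> singular_face (Suc m) (Suc j) (\<rho> xs)
         = D (del j xs)"
    by metis
  define D' where "D' xs = (if length xs = Suc m then \<rho> xs else D xs)" for xs
  show ?case
  proof (intro exI[of _ D'] allI impI)
    fix xs assume xs: "ordered_simplex xs \<and> length xs \<le> Suc m"
    show "is_cone D' xs" unfolding is_cone_def
      using xs D[of xs] \<rho>[of xs] by (cases "length xs = Suc m") (auto simp: D'_def)
  qed
qed

lemma vertices_of_simplex_in_closed_simplex:
  assumes "\<sigma> \<in> K" "f ` standard_simplex p \<subseteq> closed_simplex \<sigma>"
  shows "ordered_simplex (vertices p f)"
proof -
  have "set (vertices p f) \<subseteq> \<sigma>"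
    by (rule vertices_subset) (use assms peak_max(3) finite_simplex in blast)
  then show ?thesis
    using face_closed[OF assms(1)] by (auto simp: ordered_simplex_def)
qed

text \<open>A neighbourhood of \<open>y\<close> in which the coordinates that vanish at \<open>y\<close> remain smaller than one
  fixed other coordinate, so that rounding a point of it yields a vertex of any simplex that
  contains \<open>y\<close>.\<close>

definition peak_nhd :: "('a \<Rightarrow> real) \<Rightarrow> ('a \<Rightarrow> real) set" where
  "peak_nhd y = {x \<in> topspace X. x (peak y) > y (peak y) / 2 \<and> (\<forall>v. y v = 0 \<longrightarrow> x v < y (peak y) / 2)}"

text \<open>The definition bounds infinitely many coordinates, but on each closed simplex only
  finitely many of them can be nonzero, and this suffices in the coherent topology.\<close>

lemma openin_peak_nhd:
  assumes y: "y \<in> topspace X"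
  shows "openin X (peak_nhd y)"
  unfolding openin_geometric_realization
proof (intro conjI ballI)
  show "peak_nhd y \<subseteq> (\<Union>\<sigma>\<in>K. closed_simplex \<sigma>)" by (auto simp: peak_nhd_def)
  obtain \<sigma>' where "\<sigma>' \<in> K" "y \<in> closed_simplex \<sigma>'" using y by auto
  then have pos: "y (peak y) > 0" using peak_max(2) finite_simplex by blast
  fix \<sigma> assume \<sigma>: "\<sigma> \<in> K"
  let ?R = "powertop_real UNIV"
  let ?U = "{x \<in> topspace ?R. x (peak y) \<in> {y (peak y) / 2<..}}"
  let ?W = "\<lambda>v. {x \<in> topspace ?R. x v \<in> {..<y (peak y) / 2}}"
  have U: "openin ?R ?U"
    by (rule openin_continuous_map_preimage[OF continuous_map_product_projection]) auto
  have W: "openin ?R (?W v)" for v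
    by (rule openin_continuous_map_preimage[OF continuous_map_product_projection]) auto
  have "openin ?R (?U \<inter> (\<Inter>v\<in>A. ?W v))" if "finite A" for A
    using that
  proof (induction A rule: finite_induct)
    case empty
    then show ?case using U by simp
  next
    case (insert a A)
    have "?U \<inter> (\<Inter>v\<in>insert a A. ?W v) = (?U \<inter> (\<Inter>v\<in>A. ?W v)) \<inter> ?W a" by blast
    then show ?case using openin_Int[OF insert.IH W[of a]] by simp
  qed
  then have "openin ?R (?U \<inter> (\<Inter>v\<in>{v\<in>\<sigma>. y v = 0}. ?W v))"
    using finite_simplex[OF \<sigma>] by simp
  moreover have "peak_nhd y \<inter> closed_simplex \<sigma> = (?U \<inter> (\<Inter>v\<in>{v\<in>\<sigma>. y v = 0}. ?W v)) \<inter> closed_simplex \<sigma>"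
    using \<sigma> pos by (auto simp: peak_nhd_def) (auto simp: closed_simplex_def; metis)
  ultimately show "openin (subtopology ?R (closed_simplex \<sigma>)) (peak_nhd y \<inter> closed_simplex \<sigma>)"
    by (auto simp: openin_subtopology)
qed

lemma vertices_of_simplex_in_peak_nhd:
  assumes y: "y \<in> topspace X" and f: "f \<in> standard_simplex p \<rightarrow> peak_nhd y"
  shows "ordered_simplex (vertices p f)"
proof -
  obtain \<sigma> where \<sigma>: "\<sigma> \<in> K" "y \<in> closed_simplex \<sigma>" using y by auto
  have "peak x \<in> \<sigma>" if x: "x \<in> peak_nhd y" for x
  proof -
    obtain \<sigma>' where \<sigma>': "\<sigma>' \<in> K" "x \<in> closed_simplex \<sigma>'" using x by (auto simp: peak_nhd_def)
    have "x (peak x) > y (peak y) / 2"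
      using peak_max(1)[OF \<sigma>'(2) finite_simplex[OF \<sigma>'(1)], of "peak y"] x by (auto simp: peak_nhd_def)
    then have "y (peak x) \<noteq> 0" using x by (auto simp: peak_nhd_def)
    then show ?thesis using \<sigma>(2) by (auto simp: closed_simplex_def)
  qed
  then have "set (vertices p f) \<subseteq> \<sigma>"
    using f by (intro vertices_subset) auto
  then show ?thesis
    using face_closed[OF \<sigma>(1)] by (auto simp: ordered_simplex_def)
qed

lemma peak_nhd_cover: "topspace X \<subseteq> \<Union> (peak_nhd ` topspace X)"
proof
  fix y assume y: "y \<in> topspace X"
  then obtain \<sigma> where "\<sigma> \<in> K" "y \<in> closed_simplex \<sigma>" by auto
  then have "y (peak y) > 0" using peak_max(2) finite_simplex by blast
  then have "y \<in> peak_nhd y" using y by (simp add: peak_nhd_def)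
  then show "y \<in> \<Union> (peak_nhd ` topspace X)" using y by blast
qed

lemma iterated_subdivision_boundary:
  "singular_chain p X c \<Longrightarrow>
    chain_boundary p ((singular_subdivision p ^^ n) c)
        = (singular_subdivision (p - 1) ^^ n) (chain_boundary p c)
    \<and> singular_chain p X ((singular_subdivision p ^^ n) c)"
proof (induction n)
  case (Suc n)
  then show ?case
    using chain_boundary_singular_subdivision[of p X "(singular_subdivision p ^^ n) c"]
      singular_chain_singular_subdivision[of p X "(singular_subdivision p ^^ n) c"]
    by simp
qed simp

text \<open>A Hurewicz-type statement. For the cones \<open>D\<close>, the \<open>n\<close>-fold subdivision \<open>Sd\<close>, the chain
  homotopy \<open>h\<close> from the identity to \<open>Sd\<close>, and rounding \<open>\<theta>\<close>, the operator \<open>\<Gamma> xs = \<theta> (Sd (D xs)) +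
  \<theta> (h (spanned xs))\<close> is a contraction: \<open>\<partial> \<Gamma> + \<Gamma> \<partial> = 1\<close>. Hence a cycle \<open>z\<close> is the boundary of \<open>\<Gamma>
  z\<close>. The first term lies in the complex if the subdivision is fine enough for the finitely many
  simplices of \<open>z\<close>, the second one because \<open>h\<close> is natural and does not leave the closed
  simplex.\<close>

theorem acyclic_if_trivial_homotopy_groups:
  assumes triv: "\<And>p. p < k \<Longrightarrow> trivial_homotopy_group p X"
    and l: "1 \<le> l" "l \<le> k"
    and z: "Poly_Mapping.keys z \<subseteq> {xs. ordered_simplex xs \<and> length xs
        = l}" and bz: "lin tuple_boundary z = 0"
  shows "\<exists>y. Poly_Mapping.keys y \<subseteq> {xs. ordered_simplex xs \<and> length xs = Suc l} \<and> lin tuple_boundary y = z"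
proof -
  obtain D where "\<forall>xs. ordered_simplex xs \<and> length xs \<le> k \<longrightarrow> is_cone D xs"
    using cones_exist[OF triv] by blast
  then have D: "\<And>xs. ordered_simplex xs \<Longrightarrow> length xs \<le> k \<Longrightarrow> singular_simplex (length xs) X (D xs)"
    "\<And>xs. ordered_simplex xs \<Longrightarrow> length xs \<le> k \<Longrightarrow> xs \<noteq> [] \<Longrightarrow> singular_face (length xs) 0 (D xs) = spanned xs"
    "\<And>xs j. ordered_simplex xs \<Longrightarrow> length xs \<le> k \<Longrightarrow> j < length xs
        \<Longrightarrow> singular_face (length xs) (Suc j) (D xs) = D (del j xs)"
    by (simp_all add: is_cone_def)
  have "\<exists>n. \<forall>m f. n \<le> m \<longrightarrow> f \<in> Poly_Mapping.keys ((singular_subdivision l ^^ m) (frag_of (D xs)))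
      \<longrightarrow> ordered_simplex (vertices l f)" if "xs \<in> Poly_Mapping.keys z" for xs
  proof -
    have "ordered_simplex xs" "length xs = l" using z that by auto
    then have chain: "singular_chain l X (frag_of (D xs))"
      using D(1)[of xs] l by (simp add: singular_chain_of)
    have opens: "openin X V" if "V \<in> peak_nhd ` topspace X" for V
      using that openin_peak_nhd by blast
    obtain n where n: "\<And>m f. \<lbrakk>n \<le> m; f \<in> Poly_Mapping.keys ((singular_subdivision l ^^ m) (frag_of (D xs)))\<rbrakk>
                      \<Longrightarrow> \<exists>V \<in> peak_nhd ` topspace X. f \<in> standard_simplex l \<rightarrow> V"
      using sufficient_iterated_singular_subdivision_exists[OF opens peak_nhd_cover chain] by metis
    show ?thesis
    proof (intro exI[of _ n] allI impI)
      fix m f assume "n \<le> m" "f \<in> Poly_Mapping.keys ((singular_subdivision l ^^ m) (frag_of (D xs)))"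
      from n[OF this] show "ordered_simplex (vertices l f)" using vertices_of_simplex_in_peak_nhd by blast
    qed
  qed
  then obtain N where N: "\<And>xs m f. \<lbrakk>xs \<in> Poly_Mapping.keys z; N xs \<le> m;
     f \<in> Poly_Mapping.keys ((singular_subdivision l ^^ m) (frag_of (D xs)))\<rbrakk>
         \<Longrightarrow> ordered_simplex (vertices l f)"
    by metis
  \<comment> \<open>One number of subdivisions serves all simplices of the finite chain \<open>z\<close>.\<close>
  define n where "n = Max (N ` Poly_Mapping.keys z)"
  have small: "ordered_simplex (vertices l f)" if "xs \<in> Poly_Mapping.keys z"
    "f \<in> Poly_Mapping.keys ((singular_subdivision l ^^ n) (frag_of (D xs)))" for xs f
    using N[OF that(1) _ that(2)] that(1) by (simp add: n_def)
  obtain h :: "nat \<Rightarrow> ('a \<Rightarrow> real) chain \<Rightarrow> ('a \<Rightarrow> real) chain" where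
      h0: "\<And>p. h p 0 = 0" and hd: "\<And>p c1 c2. h p (c1-c2) = h p c1 - h p c2"
    and hc: "\<And>p Y c. singular_chain p Y c \<Longrightarrow> singular_chain (Suc p) Y (h p c)"
    and hb: "\<And>p Y c. singular_chain p Y c \<Longrightarrow> chain_boundary (Suc p) (h p c)
        + h (p - Suc 0) (chain_boundary p c)
                   = (singular_subdivision p ^^ n) c - c"
    using chain_homotopic_iterated_singular_subdivision[of n] by metis
  define \<Theta> where "\<Theta> p c = vertex_chain p ((singular_subdivision p ^^ n) c)"
    for p and c :: "('a \<Rightarrow> real) chain"
  define H where "H xs = (if xs = [] then 0 else vertex_chain (length xs) (h (length xs - 1) (frag_of
      (spanned xs))))" for xs
  define \<Gamma> where "\<Gamma> xs = \<Theta> (length xs) (frag_of (D xs)) + H xs" for xs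
  have \<Theta>_diff: "\<Theta> p (a - b) = \<Theta> p a + \<Theta> p b" for p a b
    by (simp add: \<Theta>_def singular_subdivision_power_diff vertex_chain_diff)
  have contraction: "lin tuple_boundary (\<Gamma> xs) + lin \<Gamma> (tuple_boundary xs)
      = gen xs" if xs: "ordered_simplex xs" "length xs = l" for xs
  proof -
    have ne: "xs \<noteq> []" using xs l by auto
    define p where "p = l - 1"
    have lp: "l = Suc p" using l by (simp add: p_def)
    have dl: "length (del j xs) = p" if "j < l" for j using that xs by (simp add: p_def)
    have sp: "singular_simplex p X (spanned xs)"
      using spanned_in_X[OF xs(1) ne] xs(2) by (simp add: p_def)
    \<comment> \<open>The base of the cone contributes its subdivision; the other faces are the cones over the
      faces of \<open>xs\<close>.\<close>
    have "lin tuple_boundary (\<Theta> l (frag_of (D xs))) = \<Theta> p (chain_boundary l (frag_of (D xs)))"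
      using iterated_subdivision_boundary[of l "frag_of (D xs)" n] D(1)[of xs] xs l
      by (simp add: tuple_boundary_vertex_chain[OF l(1)] \<Theta>_def singular_chain_of p_def)
    also have "\<dots> = (\<Sum>j\<le>l. \<Theta> p (frag_of (singular_face l j (D xs))))"
      using l by (simp add: chain_boundary_of mod2_additive_alternating_sum[of "\<Theta> p", OF \<Theta>_diff])
    also have "\<dots> = \<Theta> p (frag_of (spanned xs)) + (\<Sum>j<l. \<Theta> p (frag_of (D (del j xs))))"
      using D(2,3)[of xs] xs l ne by (simp add: sum.atMost_shift)
    finally have 1: "lin tuple_boundary (\<Theta> l (frag_of (D xs))) = \<Theta> p (frag_of (spanned xs))
        + (\<Sum>j<l. \<Theta> p (frag_of (D (del j xs))))" .
    \<comment> \<open>The homotopy replaces the subdivided base by the base itself, which rounds to \<open>xs\<close>.\<close>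
    have "lin tuple_boundary (H xs) = vertex_chain p (chain_boundary l (h p (frag_of (spanned xs))))"
      using ne xs by (simp add: H_def p_def tuple_boundary_vertex_chain[OF l(1)])
    also have "chain_boundary l (h p (frag_of (spanned xs)))
       = ((singular_subdivision p ^^ n) (frag_of (spanned xs)) - frag_of (spanned xs)) - h (p - 1)
           (chain_boundary p (frag_of (spanned xs)))"
      using hb[of p X "frag_of (spanned xs)"] sp by (simp add: lp singular_chain_of algebra_simps)
    also have "vertex_chain p \<dots> = \<Theta> p (frag_of (spanned xs)) + gen xs
        + vertex_chain p (h (p - 1) (chain_boundary p (frag_of (spanned xs))))"
      using vertices_spanned[OF ne] xs by (simp add: vertex_chain_diff \<Theta>_def p_def)
    also have "vertex_chain p (h (p - 1) (chain_boundary p (frag_of (spanned xs)))) = (\<Sum>j<l. H (del j xs))"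
    proof (cases "p = 0")
      case True
      then have "del 0 xs = []" using dl[of 0] l by simp
      then show ?thesis using True by (simp add: lp chain_boundary_of h0 H_def)
    next
      case False
      have "vertex_chain p (h (p - 1) (chain_boundary p (frag_of (spanned xs))))
         = (\<Sum>j\<le>p. vertex_chain p (h (p - 1) (frag_of (singular_face p j (spanned xs)))))"
        using False mod2_additive_alternating_sum[of "\<lambda>c. vertex_chain p (h (p - 1) c)"]
        by (simp add: chain_boundary_of hd vertex_chain_diff)
      also have "\<dots> = (\<Sum>j<l. H (del j xs))"
        unfolding lp lessThan_Suc_atMost
      proof (rule sum.cong[OF refl])
        fix j assume "j \<in> {..p}"
        then have j: "j < l" by (simp add: lp)
        have "singular_face p j (spanned xs) = spanned (del j xs)"
          using singular_face_spanned[of xs j] j xs False by (simp add: p_def)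
        moreover have "del j xs \<noteq> []" using dl[OF j] False by auto
        ultimately show "vertex_chain p (h (p - 1) (frag_of (singular_face p j (spanned xs))))
            = H (del j xs)"
          using dl[OF j] by (simp add: H_def)
      qed
      finally show ?thesis .
    qed
    finally have 2: "lin tuple_boundary (H xs) = \<Theta> p (frag_of (spanned xs)) + gen xs
        + (\<Sum>j<l. H (del j xs))" .
    have 3: "lin \<Gamma> (tuple_boundary xs) = (\<Sum>j<l. \<Theta> p (frag_of (D (del j xs)))) + (\<Sum>j<l. H (del j xs))"
      unfolding tuple_boundary_eq_sum lin_sum xs(2) sum.distrib[symmetric]
      by (intro sum.cong) (auto simp: \<Gamma>_def dl)
    show ?thesis
      unfolding 3 by (simp add: \<Gamma>_def lin_add xs(2) 1 2 ac_simps)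
  qed
  have \<Gamma>_keys: "Poly_Mapping.keys (\<Gamma> xs) \<subseteq> {xs. ordered_simplex xs \<and> length xs = Suc l}"
    if xs: "xs \<in> Poly_Mapping.keys z" for xs
  proof -
    have t: "ordered_simplex xs" "length xs = l" using z xs by auto
    then have ne: "xs \<noteq> []" using l by auto
    have \<sigma>: "set xs \<in> K" using t ne by (simp add: ordered_simplex_def)
    have "singular_chain (l - 1) (subtopology X (closed_simplex (set xs))) (frag_of (spanned xs))"
      using singular_simplex_spanned[OF \<sigma> ne] t by (simp add: singular_chain_of)
    from hc[OF this] have "\<forall>f\<in>Poly_Mapping.keys (h (l - 1) (frag_of (spanned xs))). f ` standard_simplex
        l \<subseteq> closed_simplex (set xs)"
      using l by (simp add: singular_chain_subtopology)
    then have "Poly_Mapping.keys (H xs) \<subseteq> {xs. ordered_simplex xs \<and> length xs = Suc l}"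
      using keys_vertex_chain[of l "h (l - 1) (frag_of (spanned xs))"]
          vertices_of_simplex_in_closed_simplex[OF \<sigma>] ne t
      by (auto simp: H_def)
    moreover have "Poly_Mapping.keys (\<Theta> l (frag_of (D xs))) \<subseteq> {xs. ordered_simplex xs \<and> length xs = Suc l}"
      unfolding \<Theta>_def using keys_vertex_chain[of l "(singular_subdivision l ^^ n) (frag_of (D xs))"]
          small[OF xs]
      by auto
    ultimately show ?thesis
      unfolding \<Gamma>_def t(2) by (intro keys_add_subset)
  qed
  have "lin tuple_boundary (lin \<Gamma> z) + lin \<Gamma> (lin tuple_boundary z)
      = lin (\<lambda>xs. lin tuple_boundary (\<Gamma> xs) + lin \<Gamma> (tuple_boundary xs)) z"
    by (simp add: lin_lin lin_fun_add)
  also have "\<dots> = lin gen z"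
    using z contraction by (intro lin_cong) auto
  finally have "lin tuple_boundary (lin \<Gamma> z) = z" using bz by simp
  then show ?thesis
    using \<Gamma>_keys by (intro exI[of _ "lin \<Gamma> z"] conjI keys_lin_subset)
qed

end

section \<open>The Borsuk graph and the Cech complex\<close>

text \<open>The values in the supremum that defines \<^const>\<open>conn\<close> are integers, so one that exceeds \<open>k - 2\<close>
  is at least \<open>k - 1\<close>.\<close>

lemma conn_gt_imp_trivial_homotopy_groups:
  assumes "\<not> conn Y \<le> ereal (real k - 2)" and "p < k"
  shows "trivial_homotopy_group p Y"
proof -
  obtain j :: int where j: "ereal (real k - 2) < ereal (real_of_int j)"
      "\<forall>i::nat. int i \<le> j \<longrightarrow> trivial_homotopy_group i Y"
    using assms(1) unfolding conn_def by (auto simp: not_le less_Sup_iff)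
  then have "int k - 2 < j" by simp
  then show ?thesis using j(2) assms(2) by simp
qed

definition antipode :: "(nat \<Rightarrow> real) \<Rightarrow> nat \<Rightarrow> real" where
  "antipode x = (\<lambda>i. - x i)"

lemma antipode_in_nsphere: "x \<in> topspace (nsphere n) \<Longrightarrow> antipode x \<in> topspace (nsphere n)"
  by (simp add: topspace_nsphere_iff antipode_def)

lemma geodesic_dist_antipode:
  assumes "x \<in> topspace (nsphere n)" "y \<in> topspace (nsphere n)"
  shows "geodesic_dist n x (antipode y) = pi - geodesic_dist n x y"
proof -
  have "-1 \<le> (\<Sum>i\<le>n. x i * y i)" "(\<Sum>i\<le>n. x i * y i) \<le> 1"
    using nsphere_inner_abs_le[OF assms] by auto
  moreover have "(\<Sum>i\<le>n. x i * antipode y i) = - (\<Sum>i\<le>n. x i * y i)"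
    by (simp add: antipode_def sum_negf)
  ultimately show ?thesis
    using assms antipode_in_nsphere[OF assms(2)] by (simp add: geodesic_dist_def arccos_minus)
qed

definition borsuk_adjacent :: "nat \<Rightarrow> real \<Rightarrow> (nat \<Rightarrow> real) \<Rightarrow> (nat \<Rightarrow> real) \<Rightarrow> bool" where
  "borsuk_adjacent n \<delta> x y \<longleftrightarrow>
     x \<in> topspace (nsphere n) \<and> y \<in> topspace (nsphere n) \<and> geodesic_dist n x y > \<delta>"

text \<open>The antipode of a common point of the balls is a common neighbour, and conversely.\<close>

lemma in_cech_complex_iff_common_neighbour:
  assumes "xs \<noteq> []"
  shows "set xs \<in> cech_complex (sphere_metric n) (pi - \<delta>) \<longleftrightarrow> has_common_neighbour (borsuk_adjacent n \<delta>) xs"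
proof
  assume "set xs \<in> cech_complex (sphere_metric n) (pi - \<delta>)"
  then obtain y where y: "\<And>x. x \<in> set xs \<Longrightarrow> y \<in> mball_of (sphere_metric n) x (pi - \<delta>)"
    unfolding cech_complex_def by blast
  have "borsuk_adjacent n \<delta> x (antipode y)" if "x \<in> set xs" for x
    using y[OF that] by (simp add: borsuk_adjacent_def geodesic_dist_antipode antipode_in_nsphere)
  then show "has_common_neighbour (borsuk_adjacent n \<delta>) xs" by (auto simp: has_common_neighbour_def)
next
  assume "has_common_neighbour (borsuk_adjacent n \<delta>) xs"
  then obtain w where w: "\<And>x. x \<in> set xs \<Longrightarrow> borsuk_adjacent n \<delta> x w"
    by (auto simp: has_common_neighbour_def)
  have "antipode w \<in> mball_of (sphere_metric n) x (pi - \<delta>)" if "x \<in> set xs" for x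
    using w[OF that] by (simp add: borsuk_adjacent_def geodesic_dist_antipode antipode_in_nsphere)
  then have "(\<Inter>x\<in>set xs. mball_of (sphere_metric n) x (pi - \<delta>)) \<noteq> {}" by blast
  moreover have "set xs \<subseteq> topspace (nsphere n)"
    using w by (auto simp: borsuk_adjacent_def)
  ultimately show "set xs \<in> cech_complex (sphere_metric n) (pi - \<delta>)"
    using assms by (simp add: cech_complex_def)
qed

lemma geodesic_dist_refl: "geodesic_dist n x x = 0"
  by (simp add: geodesic_dist_def topspace_nsphere_iff flip: power2_eq_square)

lemma simplicial_complex_cech_complex:
  assumes "r > 0"
  shows "simplicial_complex (cech_complex (sphere_metric n) r)"
proof
  show "cech_complex (sphere_metric n) r \<noteq> {}"
  proof -
    have "sphere_basepoint \<in> topspace (nsphere n)"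
      unfolding sphere_basepoint_def by (rule in_topspace_nsphere)
    moreover from this have "sphere_basepoint \<in> mball_of (sphere_metric n) sphere_basepoint r"
      using assms by (simp add: geodesic_dist_refl)
    ultimately have "{sphere_basepoint} \<in> cech_complex (sphere_metric n) r"
      by (auto simp add: cech_complex_def simp del: in_mball_of)
    then show ?thesis by blast
  qed
  show "\<tau> \<in> cech_complex (sphere_metric n) r"
    if "\<sigma> \<in> cech_complex (sphere_metric n) r" "\<tau> \<subseteq> \<sigma>" "\<tau> \<noteq> {}" for \<sigma> \<tau>
  proof -
    have "(\<Inter>x\<in>\<sigma>. mball_of (sphere_metric n) x r) \<subseteq> (\<Inter>x\<in>\<tau>. mball_of (sphere_metric n) x r)"
      using that(2) by (rule INF_superset_mono) simp
    then show ?thesis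
      using that finite_subset[of \<tau> \<sigma>] by (auto simp: cech_complex_def simp del: in_mball_of INT_iff)
  qed
qed (auto simp: cech_complex_def)

text \<open>Each point is coloured by a covering ball of radius \<open>r < \<delta> / 2\<close> that contains it; two
  points of one such ball are at distance at most \<open>2 * r < \<delta>\<close>.\<close>

lemma covering_radius_less_imp_colouring:
  assumes "covering_radius (sphere_metric n) (k + 1) < \<delta> / 2"
  obtains c where "\<And>x y. borsuk_adjacent n \<delta> x y \<Longrightarrow> c x \<noteq> c y"
    "\<And>x y. borsuk_adjacent n \<delta> x y \<Longrightarrow> c x \<le> k"
proof -
  interpret Metric_space "topspace (nsphere n)" "geodesic_dist n" by (rule Metric_space_geodesic)
  define R where "R = {r. 0 \<le> r \<and> (\<exists>x::nat \<Rightarrow> nat \<Rightarrow> real. (\<forall>i\<in>{1..k+1}. x i \<in> mspace (sphere_metric n)) \<and>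
      (\<Union>i\<in>{1..k+1}. mcball_of (sphere_metric n) (x i) r) = mspace (sphere_metric n))}"
  \<comment> \<open>The sphere has diameter \<open>\<pi>\<close>, so the set of admissible radii is nonempty and its infimum is
    approached.\<close>
  have "pi \<in> R"
  proof -
    have b: "sphere_basepoint \<in> topspace (nsphere n)"
      unfolding sphere_basepoint_def by (rule in_topspace_nsphere)
    have "geodesic_dist n x y \<le> pi" for x y
      using nsphere_inner_abs_le[of x n y] by (auto simp: geodesic_dist_def abs_le_iff intro!:
          arccos_ubound)
    then show ?thesis
      using b by (auto simp: R_def intro!: exI[of _ "\<lambda>_. sphere_basepoint"])
  qed
  moreover have "Inf R < \<delta> / 2"
    using assms by (simp add: covering_radius_def R_def)
  ultimately obtain r where r: "r \<in> R" "r < \<delta> / 2"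
    using cInf_lessD[of R "\<delta> / 2"] by blast
  then obtain x where x: "(\<Union>i\<in>{1..k+1}. mcball_of (sphere_metric n) (x i) r) = topspace (nsphere n)"
    by (auto simp: R_def)
  define c where "c z = (SOME i. i \<in> {1..k+1} \<and> z \<in> mcball_of (sphere_metric n) (x i) r)" for z
  have c: "c z \<in> {1..k+1} \<and> z \<in> mcball_of (sphere_metric n) (x (c z)) r" if "z \<in> topspace (nsphere n)" for z
  proof -
    have "\<exists>i. i \<in> {1..k+1} \<and> z \<in> mcball_of (sphere_metric n) (x i) r" using x that by blast
    then show ?thesis unfolding c_def by (rule someI_ex)
  qed
  show thesis
  proof
    fix z y assume zy: "borsuk_adjacent n \<delta> z y"
    then have S: "z \<in> topspace (nsphere n)" "y \<in> topspace (nsphere n)" by (auto simp: borsuk_adjacent_def)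
    \<comment> \<open>The centres are numbered from 1, the colours from 0.\<close>
    show "c z - 1 \<le> k" using c[OF S(1)] by auto
    show "c z - 1 \<noteq> c y - 1"
    proof
      assume "c z - 1 = c y - 1"
      then have eq: "c z = c y" using c[OF S(1)] c[OF S(2)] by auto
      have "geodesic_dist n z y \<le> geodesic_dist n (x (c z)) z + geodesic_dist n (x (c z)) y"
        using c[OF S(1)] S triangle''[of z "x (c z)" y] by (auto simp: commute)
      also have "\<dots> \<le> r + r"
        using c[OF S(1)] c[OF S(2)] eq by (intro add_mono) auto
      finally show False using zy r(2) by (simp add: borsuk_adjacent_def)
    qed
  qed
qed

theorem proposition5p3:
  fixes n k :: nat and \<delta> :: real
  assumes "1 \<le> n"
    and "0 < \<delta>" and "\<delta> < pi"
    and "1 \<le> k"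
    and "\<delta> > 2 * covering_radius (sphere_metric n) (k + 1)"
  shows "conn (geometric_realization (cech_complex (sphere_metric n) (pi - \<delta>)))
           \<le> ereal (real k - 2)"
proof (rule ccontr)
  let ?K = "cech_complex (sphere_metric n) (pi - \<delta>)"
  let ?E = "borsuk_adjacent n \<delta>"
  assume "\<not> ?thesis"
  then have triv: "trivial_homotopy_group p (geometric_realization ?K)" if "p < k" for p
    using that by (rule conn_gt_imp_trivial_homotopy_groups)
  interpret simplicial_complex ?K
    using assms(3) by (intro simplicial_complex_cech_complex) simp
  have ordered_simplex: "ordered_simplex xs \<longleftrightarrow> has_common_neighbour ?E xs" for xs
    using in_cech_complex_iff_common_neighbour[of xs n \<delta>] by (cases "xs
        = []") (auto simp: ordered_simplex_def has_common_neighbour_def)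
  obtain c where c: "\<And>x y. ?E x y \<Longrightarrow> c x \<noteq> c y" "\<And>x y. ?E x y \<Longrightarrow> c x \<le> k"
    using covering_radius_less_imp_colouring[of n k \<delta>] assms(5) by auto
  have b: "sphere_basepoint \<in> topspace (nsphere n)"
    unfolding sphere_basepoint_def by (rule in_topspace_nsphere)
  show False
  proof (rule acyclic_neighbourhood_complex_not_colourable[where E = ?E and c = c and k = k])
    show "?E y x" if "?E x y" for x y
      using that Metric_space.commute[OF Metric_space_geodesic, of n x y]
          by (auto simp: borsuk_adjacent_def)
    show "?E sphere_basepoint (antipode sphere_basepoint)"
      using b assms(3) by (simp add: borsuk_adjacent_def antipode_in_nsphere geodesic_dist_antipode
          geodesic_dist_refl)
    show "\<exists>y. Poly_Mapping.keys y \<subseteq> {xs. has_common_neighbour ?E xs \<and> length xs = Suc l}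
        \<and> lin tuple_boundary y = z"
      if "1 \<le> l" "l \<le> k" "Poly_Mapping.keys z \<subseteq> {xs. has_common_neighbour ?E xs \<and> length xs
          = l}" "lin tuple_boundary z = 0" for l z
      using acyclic_if_trivial_homotopy_groups[OF triv that(1,2), of z] that(3,4)
          by (simp add: ordered_simplex)
  qed (use c in auto)
qed

end
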